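(* Let $R$ be a semiprime ring and $S\in \mathrm{Den}_l(R,0)$. Then: 1. The ring $S^{-1}R$ is a semiprime ring. 2. If, in addition, $|\min(R)|<\infty$ then $\min(S^{-1}R)=\{S^{-1}\mathfrak{p}\mid \mathfrak{p}\in\min(R)\}$, i.e. the map $\min(R)\to\min(S^{-1}R)$, $\mathfrak{p}\mapsto S^{-1}\mathfrak{p}$ is a bijection and $|\min(S^{-1}R)|=|\min(R)|$. 3. If, in addition, $|\min(R)|<\infty$ then for each $\mathfrak{p}\in\min(R)$, $\pi_{\mathfrak{p}}(S)\in\mathrm{Den}_l(R/\mathfrak{p},0)$ and $$\pi_{\mathfrak{p}}(S)^{-1}(R/\mathfrak{p})\simeq S^{-1}R/S^{-1}\mathfrak{p}\simeq S^{-1}(R/\mathfrak{p}),$$ where $\pi_{\mathfrak{p}}:R\to R/\mathfrak{p}$, $r\mapsto r+\mathfrak{p}$.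
   Context: Rings are associative with $1$. A multiplicative subset $S$ of $R$ is a multiplicative subsemigroup with $1\in S$, $0\notin S$. It is a left Ore set if $Sr\cap Rs\neq\emptyset$ for all $r\in R$, $s\in S$; then $\mathrm{ass}_l(S)=\{r\in R\mid sr=0 \text{ for some } s\in S\}$ is an ideal. A left Ore set $S$ is a left denominator set if $rs=0$ with $r\in R$, $s\in S$ implies $tr=0$ for some $t\in S$. $\mathrm{Den}_l(R,\mathfrak{a})$ is the set of left denominator sets $S$ of $R$ with $\mathrm{ass}_l(S)=\mathfrak{a}$. $S^{-1}R=\{s^{-1}r\mid s\in S,r\in R\}$ is the left localization, $S^{-1}\mathfrak{p}=\{s^{-1}p\mid s\in S,p\in\mathfrak{p}\}$, and $S^{-1}(R/\mathfrak{p})$ is the localization of the left $R$-module $R/\mathfrak{p}$ at $S$. A ring is semiprime if the intersection of all its prime ideals is zero (equivalently, it has no nonzero nilpotent ideals). $\min(R)$ is the set of minimal prime ideals of $R$. *)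

theory Defs
  imports "HOL-Algebra.QuotRing" "HOL-Algebra.Ideal_Product" "HOL-Algebra.Module"
begin

section \<open>Prime and semiprime rings\<close>

text \<open>The library's \<open>primeideal\<close> and \<open>module\<close> are restricted to commutative rings, so the
  noncommutative notions are introduced here.\<close>

definition prime_ideal :: "('a, 'b) ring_scheme \<Rightarrow> 'a set \<Rightarrow> bool" where
  "prime_ideal R P \<longleftrightarrow> ideal P R \<and> P \<noteq> carrier R \<and>
     (\<forall>I J. ideal I R \<longrightarrow> ideal J R \<longrightarrow> ideal_prod R I J \<subseteq> P \<longrightarrow> I \<subseteq> P \<or> J \<subseteq> P)"

definition min_primes :: "('a, 'b) ring_scheme \<Rightarrow> 'a set set" where
  "min_primes R = {P. prime_ideal R P \<and> (\<forall>P'. prime_ideal R P' \<longrightarrow> P' \<subseteq> P \<longrightarrow> P' = P)}"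

text \<open>The intersection is taken inside the carrier, so a ring without prime ideals is
  semiprime only if it is the zero ring.\<close>

definition semiprime_ring :: "('a, 'b) ring_scheme \<Rightarrow> bool" where
  "semiprime_ring R \<longleftrightarrow> ring R \<and> {x \<in> carrier R. \<forall>P. prime_ideal R P \<longrightarrow> x \<in> P} = {\<zero>\<^bsub>R\<^esub>}"


section \<open>Left denominator sets\<close>

definition multiplicative_subset :: "('a, 'b) ring_scheme \<Rightarrow> 'a set \<Rightarrow> bool" where
  "multiplicative_subset R S \<longleftrightarrow> S \<subseteq> carrier R \<and> (\<forall>s\<in>S. \<forall>t\<in>S. s \<otimes>\<^bsub>R\<^esub> t \<in> S) \<and>
     \<one>\<^bsub>R\<^esub> \<in> S \<and> \<zero>\<^bsub>R\<^esub> \<notin> S"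

definition left_ore_set :: "('a, 'b) ring_scheme \<Rightarrow> 'a set \<Rightarrow> bool" where
  "left_ore_set R S \<longleftrightarrow> multiplicative_subset R S \<and>
     (\<forall>r\<in>carrier R. \<forall>s\<in>S. {t \<otimes>\<^bsub>R\<^esub> r |t. t \<in> S} \<inter> {x \<otimes>\<^bsub>R\<^esub> s |x. x \<in> carrier R} \<noteq> {})"

definition ass_l :: "('a, 'b) ring_scheme \<Rightarrow> 'a set \<Rightarrow> 'a set" where
  "ass_l R S = {r \<in> carrier R. \<exists>s\<in>S. s \<otimes>\<^bsub>R\<^esub> r = \<zero>\<^bsub>R\<^esub>}"

definition left_denominator_set :: "('a, 'b) ring_scheme \<Rightarrow> 'a set \<Rightarrow> bool" where
  "left_denominator_set R S \<longleftrightarrow> left_ore_set R S \<and>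
     (\<forall>r\<in>carrier R. \<forall>s\<in>S. r \<otimes>\<^bsub>R\<^esub> s = \<zero>\<^bsub>R\<^esub> \<longrightarrow> (\<exists>t\<in>S. t \<otimes>\<^bsub>R\<^esub> r = \<zero>\<^bsub>R\<^esub>))"

definition Den_l :: "('a, 'b) ring_scheme \<Rightarrow> 'a set \<Rightarrow> 'a set set" where
  "Den_l R \<aa> = {S. left_denominator_set R S \<and> ass_l R S = \<aa>}"


section \<open>Left modules over noncommutative rings\<close>

text \<open>Modules are represented by the library record \<open>module\<close>, whose fields \<open>mult\<close> and
  \<open>one\<close> play no role.\<close>

locale left_module = R?: ring R + M?: abelian_group M
  for R :: "('a, 'c) ring_scheme" (structure) and M :: "('a, 'b, 'd) module_scheme" (structure) +
  assumes smult_closed: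
      "\<lbrakk>a \<in> carrier R; x \<in> carrier M\<rbrakk> \<Longrightarrow> a \<odot>\<^bsub>M\<^esub> x \<in> carrier M"
    and smult_l_distr:
      "\<lbrakk>a \<in> carrier R; b \<in> carrier R; x \<in> carrier M\<rbrakk> \<Longrightarrow>
        (a \<oplus>\<^bsub>R\<^esub> b) \<odot>\<^bsub>M\<^esub> x = a \<odot>\<^bsub>M\<^esub> x \<oplus>\<^bsub>M\<^esub> b \<odot>\<^bsub>M\<^esub> x"
    and smult_r_distr:
      "\<lbrakk>a \<in> carrier R; x \<in> carrier M; y \<in> carrier M\<rbrakk> \<Longrightarrow>
        a \<odot>\<^bsub>M\<^esub> (x \<oplus>\<^bsub>M\<^esub> y) = a \<odot>\<^bsub>M\<^esub> x \<oplus>\<^bsub>M\<^esub> a \<odot>\<^bsub>M\<^esub> y"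
    and smult_assoc1:
      "\<lbrakk>a \<in> carrier R; b \<in> carrier R; x \<in> carrier M\<rbrakk> \<Longrightarrow>
        (a \<otimes>\<^bsub>R\<^esub> b) \<odot>\<^bsub>M\<^esub> x = a \<odot>\<^bsub>M\<^esub> (b \<odot>\<^bsub>M\<^esub> x)"
    and smult_one:
      "x \<in> carrier M \<Longrightarrow> \<one>\<^bsub>R\<^esub> \<odot>\<^bsub>M\<^esub> x = x"

definition left_module_isomorphic ::
    "('a, 'c) ring_scheme \<Rightarrow> ('a, 'm, 'd) module_scheme \<Rightarrow> ('a, 'n, 'e) module_scheme \<Rightarrow> bool"
  where "left_module_isomorphic R M N \<longleftrightarrow> left_module R M \<and> left_module R N \<and>
    (\<exists>f. bij_betw f (carrier M) (carrier N) \<and>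
      (\<forall>x\<in>carrier M. \<forall>y\<in>carrier M. f (x \<oplus>\<^bsub>M\<^esub> y) = f x \<oplus>\<^bsub>N\<^esub> f y) \<and>
      (\<forall>r\<in>carrier R. \<forall>x\<in>carrier M. f (r \<odot>\<^bsub>M\<^esub> x) = r \<odot>\<^bsub>N\<^esub> f x))"

definition regular_module :: "('a, 'b) ring_scheme \<Rightarrow> ('a, 'a) module" where
  "regular_module R =
    \<lparr>carrier = carrier R, mult = mult R, one = one R, zero = zero R, add = add R,
     smult = mult R\<rparr>"

text \<open>The left module \<open>R/I\<close>, with \<open>r (x + I) = r x + I\<close>.\<close>

definition quotient_module :: "('a, 'b) ring_scheme \<Rightarrow> 'a set \<Rightarrow> ('a, 'a set) module" where
  "quotient_module R I =
    \<lparr>carrier = carrier (R Quot I), mult = mult (R Quot I), one = one (R Quot I),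
     zero = zero (R Quot I), add = add (R Quot I),
     smult = (\<lambda>r X. \<Union>x\<in>X. I +>\<^bsub>R\<^esub> (r \<otimes>\<^bsub>R\<^esub> x))\<rparr>"


section \<open>Left Ore localization\<close>

text \<open>\<open>lfrac R S M s x\<close> is the fraction \<open>s\<^sup>-\<^sup>1x\<close>. Two fractions \<open>s\<^sup>-\<^sup>1x\<close> and \<open>t\<^sup>-\<^sup>1y\<close> agree
  iff they can be expanded to the same numerator over the same denominator, that is
  \<open>as = bt \<in> S\<close> and \<open>ax = by\<close> for some \<open>a, b \<in> R\<close>; the factors \<open>a\<close> and \<open>b\<close> themselves need
  not lie in \<open>S\<close>.\<close>

definition lfrac_rel ::
    "('a, 'c) ring_scheme \<Rightarrow> 'a set \<Rightarrow> ('a, 'm, 'd) module_scheme \<Rightarrow> (('a \<times> 'm) \<times> ('a \<times> 'm)) set"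
  where "lfrac_rel R S M =
    {((s, x), (t, y)) |s x t y. s \<in> S \<and> t \<in> S \<and> x \<in> carrier M \<and> y \<in> carrier M \<and>
      (\<exists>a\<in>carrier R. \<exists>b\<in>carrier R. a \<otimes>\<^bsub>R\<^esub> s = b \<otimes>\<^bsub>R\<^esub> t \<and> a \<otimes>\<^bsub>R\<^esub> s \<in> S \<and> a \<odot>\<^bsub>M\<^esub> x = b \<odot>\<^bsub>M\<^esub> y)}"

definition lfrac ::
    "('a, 'c) ring_scheme \<Rightarrow> 'a set \<Rightarrow> ('a, 'm, 'd) module_scheme \<Rightarrow> 'a \<Rightarrow> 'm \<Rightarrow> ('a \<times> 'm) set"
  where "lfrac R S M s x = lfrac_rel R S M `` {(s, x)}"

text \<open>If \<open>us = at\<close> with \<open>u \<in> S\<close>, then \<open>s\<^sup>-\<^sup>1x + t\<^sup>-\<^sup>1y = (us)\<^sup>-\<^sup>1(ux + ay)\<close>.  If \<open>ur = at\<close> with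
  \<open>u \<in> S\<close>, then \<open>rt\<^sup>-\<^sup>1 = u\<^sup>-\<^sup>1a\<close>, so that \<open>s\<^sup>-\<^sup>1r \<cdot> t\<^sup>-\<^sup>1y = (us)\<^sup>-\<^sup>1ay\<close>.  As in the library's
  \<open>rcoset_mult\<close>, the operations on classes are unions over all representatives and over
  all choices of \<open>u\<close> and \<open>a\<close>; for a left denominator set all these choices give the same class.\<close>

definition lfrac_add ::
    "('a, 'c) ring_scheme \<Rightarrow> 'a set \<Rightarrow> ('a, 'm, 'd) module_scheme \<Rightarrow>
      ('a \<times> 'm) set \<Rightarrow> ('a \<times> 'm) set \<Rightarrow> ('a \<times> 'm) set"
  where "lfrac_add R S M X Y =
    (\<Union>(s, x)\<in>X. \<Union>(t, y)\<in>Y. \<Union>u\<in>S. \<Union>a\<in>{a \<in> carrier R. u \<otimes>\<^bsub>R\<^esub> s = a \<otimes>\<^bsub>R\<^esub> t}.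
      lfrac R S M (u \<otimes>\<^bsub>R\<^esub> s) (u \<odot>\<^bsub>M\<^esub> x \<oplus>\<^bsub>M\<^esub> a \<odot>\<^bsub>M\<^esub> y))"

definition lfrac_smult ::
    "('a, 'c) ring_scheme \<Rightarrow> 'a set \<Rightarrow> ('a, 'm, 'd) module_scheme \<Rightarrow>
      ('a \<times> 'a) set \<Rightarrow> ('a \<times> 'm) set \<Rightarrow> ('a \<times> 'm) set"
  where "lfrac_smult R S M X Y =
    (\<Union>(s, r)\<in>X. \<Union>(t, y)\<in>Y. \<Union>u\<in>S. \<Union>a\<in>{a \<in> carrier R. u \<otimes>\<^bsub>R\<^esub> r = a \<otimes>\<^bsub>R\<^esub> t}.
      lfrac R S M (u \<otimes>\<^bsub>R\<^esub> s) (a \<odot>\<^bsub>M\<^esub> y))"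

text \<open>The left \<open>S\<^sup>-\<^sup>1R\<close>-module \<open>S\<^sup>-\<^sup>1M\<close>.\<close>

definition loc_module ::
    "('a, 'c) ring_scheme \<Rightarrow> 'a set \<Rightarrow> ('a, 'm, 'd) module_scheme \<Rightarrow>
      (('a \<times> 'a) set, ('a \<times> 'm) set) module"
  where "loc_module R S M =
    \<lparr>carrier = {lfrac R S M s x |s x. s \<in> S \<and> x \<in> carrier M},
     mult = undefined, one = undefined,
     zero = lfrac R S M \<one>\<^bsub>R\<^esub> \<zero>\<^bsub>M\<^esub>,
     add = lfrac_add R S M,
     smult = lfrac_smult R S M\<rparr>"

definition loc_ring :: "('a, 'c) ring_scheme \<Rightarrow> 'a set \<Rightarrow> ('a \<times> 'a) set ring" where
  "loc_ring R S =
    \<lparr>carrier = {lfrac R S (regular_module R) s r |s r. s \<in> S \<and> r \<in> carrier R},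
     mult = lfrac_smult R S (regular_module R),
     one = lfrac R S (regular_module R) \<one>\<^bsub>R\<^esub> \<one>\<^bsub>R\<^esub>,
     zero = lfrac R S (regular_module R) \<one>\<^bsub>R\<^esub> \<zero>\<^bsub>R\<^esub>,
     add = lfrac_add R S (regular_module R)\<rparr>"

text \<open>The subset \<open>S\<^sup>-\<^sup>1I = {s\<^sup>-\<^sup>1p | s \<in> S, p \<in> I}\<close> of \<open>S\<^sup>-\<^sup>1R\<close>.\<close>

definition loc_ideal :: "('a, 'c) ring_scheme \<Rightarrow> 'a set \<Rightarrow> 'a set \<Rightarrow> ('a \<times> 'a) set set" where
  "loc_ideal R S I = {lfrac R S (regular_module R) s p |s p. s \<in> S \<and> p \<in> I}"

end

theory Submission
  imports Defs "HOL-Algebra.Ring_Divisibility"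
begin

text \<open>Contraction embeds the ideals of \<open>S\<^sup>-\<^sup>1R\<close> into those of \<open>R\<close> and reflects
  square-zero ideals, which gives semiprimeness.  If \<open>R\<close> has finitely many minimal primes, each
  one is the left and the right annihilator of the intersection of the others.  Hence it absorbs
  factors from \<open>S\<close> on both sides: if \<open>sa\<close> or \<open>as\<close> lies in \<open>\<pp>\<close>, so does \<open>a\<close>.  This makes
  \<open>S\<^sup>-\<^sup>1\<pp>\<close> a two-sided prime ideal contracting to \<open>\<pp>\<close>, and makes the image of \<open>S\<close> in \<open>R/\<pp>\<close>
  a regular left Ore set.  The primes \<open>S\<^sup>-\<^sup>1\<pp>\<close> are incomparable and have zero intersection, so
  they are the minimal primes of \<open>S\<^sup>-\<^sup>1R\<close>.\<close>

section \<open>Prime ideals in noncommutative rings\<close>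

text \<open>The obstacle is one-sidedness. For an ideal \<open>I\<close> of \<open>R\<close>, the
  fractions with numerator in \<open>I\<close> are stable under left multiplication, but a product
  of s^-1 x with t^-1 a is computed after rewriting s^-1 x as w^-1 (y t), and x in \<open>I\<close>
  yields only y t in \<open>I\<close>. Cancelling t is what absorption on the right supplies, and
  annihilators have it on both sides because elements of \<open>S\<close> are regular on both sides.
  That P is an annihilator comes from P Q = Q P = 0, where Q is the intersection of the other
  minimal primes, together with primeness; finiteness is what keeps Q from lying inside P.

  Semiprimeness is defined through prime ideals, while contraction handles products of ideals well,
  so the criterion by square-zero ideals has to be available for arbitrary rings, without chain
  conditions. Both \<open>R\<close> and R/P are modules on which \<open>S\<close> acts injectively,
  so one calculus of fractions covers the localized ring and the localized module.\<close>

context ring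
begin

lemma ideal_prod_subset_iff:
  assumes "ideal P R"
  shows "ideal_prod R I J \<subseteq> P \<longleftrightarrow> (\<forall>i\<in>I. \<forall>j\<in>J. i \<otimes> j \<in> P)"
proof
  assume *: "\<forall>i\<in>I. \<forall>j\<in>J. i \<otimes> j \<in> P"
  interpret P: ideal P R by fact
  show "ideal_prod R I J \<subseteq> P"
  proof
    fix x assume "x \<in> ideal_prod R I J"
    then show "x \<in> P"
      using * by (induction rule: ideal_prod.induct) auto
  qed
qed (auto intro: ideal_prod.prod)

text \<open>Replaces the additively generated \<open>ideal_prod\<close> by products of elements, the
  only form in which primeness is tested below.\<close>

lemma prime_ideal_iff:
  "prime_ideal R P \<longleftrightarrow> ideal P R \<and> P \<noteq> carrier R \<and>
    (\<forall>I J. ideal I R \<longrightarrow> ideal J R \<longrightarrow> (\<forall>i\<in>I. \<forall>j\<in>J. i \<otimes> j \<in> P) \<longrightarrow> I \<subseteq> P \<or> J \<subseteq> P)"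
  unfolding prime_ideal_def using ideal_prod_subset_iff by metis

lemma prime_idealD:
  assumes "prime_ideal R P" "ideal I R" "ideal J R" "\<And>i j. i \<in> I \<Longrightarrow> j \<in> J \<Longrightarrow> i \<otimes> j \<in> P"
  shows "I \<subseteq> P \<or> J \<subseteq> P"
  using assms unfolding prime_ideal_iff by blast

lemma prime_ideal_ideal: "prime_ideal R P \<Longrightarrow> ideal P R"
  by (simp add: prime_ideal_def)

lemma prime_ideal_proper: "prime_ideal R P \<Longrightarrow> P \<subset> carrier R"
  using ideal.Icarr[of P R] unfolding prime_ideal_def by blast

text \<open>Additive inverses come for free: the negative of x is (-1) x, and left multiples stay
  inside.\<close>

lemma idealI_elementwise:
  assumes "I \<subseteq> carrier R" "\<zero> \<in> I"
    and "\<And>x y. x \<in> I \<Longrightarrow> y \<in> I \<Longrightarrow> x \<oplus> y \<in> I"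
    and "\<And>x a. x \<in> I \<Longrightarrow> a \<in> carrier R \<Longrightarrow> a \<otimes> x \<in> I"
    and "\<And>x a. x \<in> I \<Longrightarrow> a \<in> carrier R \<Longrightarrow> x \<otimes> a \<in> I"
  shows "ideal I R"
proof (rule idealI)
  show "subgroup I (add_monoid R)"
  proof (rule add.subgroupI)
    fix x assume "x \<in> I"
    moreover from this have "\<ominus> x = (\<ominus> \<one>) \<otimes> x"
      using assms(1) by (auto simp: l_minus)
    ultimately show "\<ominus> x \<in> I"
      using assms(4)[of x "\<ominus> \<one>"] by simp
  qed (use assms in auto)
qed (use assms ring_axioms in auto)

text \<open>Intersecting with the carrier makes the empty family give the unit ideal. This case
  occurs when \<open>R\<close> has a single minimal prime and the intersection of the others is
  formed.\<close>

lemma ideal_Inter_carrier: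
  assumes "\<And>I. I \<in> F \<Longrightarrow> ideal I R"
  shows "ideal (carrier R \<inter> \<Inter>F) R"
  using i_Intersect[of "insert (carrier R) F"] assms oneideal by auto

text \<open>Two annihilators replace the ideal generated by \<open>x\<close>. The set
  \<open>A\<close> of all y with x R y = 0 is an ideal containing \<open>x\<close>, and its left
  annihilator \<open>B\<close> contains \<open>x\<close> as well. Since \<open>B\<close> kills
  \<open>A\<close>, the ideal formed by their intersection squares to zero.\<close>

lemma square_zero_element:
  assumes sq: "\<And>I. ideal I R \<Longrightarrow> (\<And>x y. x \<in> I \<Longrightarrow> y \<in> I \<Longrightarrow> x \<otimes> y = \<zero>) \<Longrightarrow> I = {\<zero>}"
    and x: "x \<in> carrier R" and zero: "\<And>r. r \<in> carrier R \<Longrightarrow> x \<otimes> r \<otimes> x = \<zero>"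
  shows "x = \<zero>"
proof -
  define A where "A = {y \<in> carrier R. \<forall>r\<in>carrier R. x \<otimes> r \<otimes> y = \<zero>}"
  define B where "B = {z \<in> carrier R. \<forall>y\<in>A. z \<otimes> y = \<zero>}"
  have A: "ideal A R"
  proof (rule idealI_elementwise)
    fix y a assume "y \<in> A" and a: "a \<in> carrier R"
    then have y: "y \<in> carrier R" "\<And>r. r \<in> carrier R \<Longrightarrow> x \<otimes> r \<otimes> y = \<zero>"
      by (auto simp: A_def)
    have "x \<otimes> r \<otimes> (a \<otimes> y) = \<zero>" if "r \<in> carrier R" for r
      using y(2)[of "r \<otimes> a"] y(1) that a x by (simp add: m_assoc)
    moreover have "x \<otimes> r \<otimes> (y \<otimes> a) = \<zero>" if "r \<in> carrier R" for r
      using y(2)[of r] y(1) that a x m_assoc[of "x \<otimes> r" y a] by simp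
    ultimately show "a \<otimes> y \<in> A" "y \<otimes> a \<in> A"
      using y(1) a by (auto simp: A_def)
  qed (use x in \<open>auto simp: A_def r_distr\<close>)
  then interpret A: ideal A R .
  have B: "ideal B R"
  proof (rule idealI_elementwise)
    fix z a assume "z \<in> B" and a: "a \<in> carrier R"
    then have z: "z \<in> carrier R" "\<And>y. y \<in> A \<Longrightarrow> z \<otimes> y = \<zero>"
      by (auto simp: B_def)
    show "a \<otimes> z \<in> B" "z \<otimes> a \<in> B"
      using z a A.I_l_closed by (auto simp: B_def m_assoc)
  qed (auto simp: B_def l_distr)
  have "ideal (A \<inter> B) R"
    using A B by (rule i_intersect)
  then have "A \<inter> B = {\<zero>}"
    by (rule sq) (auto simp: B_def)
  moreover have "x \<in> A"
    unfolding A_def using x zero by blast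
  moreover have "x \<in> B"
  proof -
    have "x \<otimes> \<one> \<otimes> y = \<zero>" if "y \<in> A" for y
      using that one_closed unfolding A_def by blast
    then show ?thesis
      using x unfolding B_def by simp
  qed
  ultimately show ?thesis
    by blast
qed

text \<open>A prime ideal avoiding \<open>x\<close> is found as an ideal maximal among those disjoint from an
  m-sequence \<open>x\<^sub>0 = x\<close>, \<open>x\<^sub>n\<^sub>+\<^sub>1 = x\<^sub>n r\<^sub>n x\<^sub>n \<noteq> 0\<close>.\<close>

lemma exists_prime_avoiding:
  assumes sq: "\<And>I. ideal I R \<Longrightarrow> (\<And>x y. x \<in> I \<Longrightarrow> y \<in> I \<Longrightarrow> x \<otimes> y = \<zero>) \<Longrightarrow> I = {\<zero>}"
    and x: "x \<in> carrier R" "x \<noteq> \<zero>"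
  shows "\<exists>P. prime_ideal R P \<and> x \<notin> P"
proof -
  have "\<exists>r\<in>carrier R. y \<otimes> r \<otimes> y \<noteq> \<zero>" if "y \<in> carrier R" "y \<noteq> \<zero>" for y
    using square_zero_element[OF sq] that by blast
  then obtain r where r: "\<And>y. y \<in> carrier R \<Longrightarrow> y \<noteq> \<zero> \<Longrightarrow> r y \<in> carrier R \<and> y \<otimes> r y \<otimes> y \<noteq> \<zero>"
    by metis
  define f where "f = rec_nat x (\<lambda>_ y. y \<otimes> r y \<otimes> y)"
  have f0: "f 0 = x" and fS: "f (Suc n) = f n \<otimes> r (f n) \<otimes> f n" for n
    by (simp_all add: f_def)
  have fc: "f n \<in> carrier R \<and> f n \<noteq> \<zero>" for n
    by (induction n) (use x r in \<open>auto simp: f0 fS\<close>)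
  \<comment> \<open>Each term is a multiple of its predecessor, so an ideal that meets the sequence
    contains a whole tail of it. Two such ideals therefore share a term.\<close>
  have up: "f k \<in> I" if "ideal I R" "f n \<in> I" "n \<le> k" for I n k
    using that(3)
  proof (induction rule: dec_induct)
    case (step k)
    then show ?case
      using ideal.I_l_closed[OF that(1) step.IH] r fc by (simp add: fS)
  qed (fact that(2))
  let ?A = "{I. ideal I R \<and> I \<inter> range f = {}}"
  have "\<exists>P\<in>?A. \<forall>X\<in>?A. P \<subseteq> X \<longrightarrow> X = P"
  proof (rule subset_Zorn_nonempty)
    have "{\<zero>} \<in> ?A"
      using fc zeroideal by (auto simp: eq_commute)
    then show "?A \<noteq> {}"
      by blast
    fix C assume C: "C \<noteq> {}" "subset.chain ?A C"
    then have "C \<subseteq> ?A" and "subset.chain {I. ideal I R} C"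
      unfolding subset_chain_def by blast+
    moreover from this have "ideal (\<Union>C) R"
      using chain_Union_is_ideal[of C] C(1) by simp
    ultimately show "\<Union>C \<in> ?A"
      by blast
  qed
  then obtain P where "P \<in> ?A" and "\<forall>X\<in>?A. P \<subseteq> X \<longrightarrow> X = P" ..
  then have P: "ideal P R" "P \<inter> range f = {}"
    and max: "\<And>X. ideal X R \<Longrightarrow> X \<inter> range f = {} \<Longrightarrow> P \<subseteq> X \<Longrightarrow> X = P"
    by simp_all
  interpret P: ideal P R by fact
  \<comment> \<open>\<open>P + I\<close> is strictly larger than \<open>P\<close>, so maximality
    forces it to meet the sequence.\<close>
  have grow: "\<exists>n. f n \<in> P <+>\<^bsub>R\<^esub> I" if I: "ideal I R" "\<not> I \<subseteq> P" for I
  proof (rule ccontr)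
    assume n: "\<nexists>n. f n \<in> P <+>\<^bsub>R\<^esub> I"
    interpret I: ideal I R by fact
    have set_add_mem: "p \<oplus> i \<in> P <+>\<^bsub>R\<^esub> I" if "p \<in> P" "i \<in> I" for p i
      using that unfolding set_add_def' by blast
    have "p \<in> P <+>\<^bsub>R\<^esub> I" if "p \<in> P" for p
      using set_add_mem[OF that I.zero_closed] that by simp
    moreover have "i \<in> P <+>\<^bsub>R\<^esub> I" if "i \<in> I" for i
      using set_add_mem[OF P.zero_closed that] that by simp
    ultimately show False
      using max[OF add_ideals[OF P(1) I(1)]] n I(2) by blast
  qed
  have "prime_ideal R P"
    unfolding prime_ideal_iff
  proof (intro conjI allI impI)
    show "P \<noteq> carrier R"
      using P(2) fc by blast
    fix I J assume IJ: "ideal I R" "ideal J R" "\<forall>i\<in>I. \<forall>j\<in>J. i \<otimes> j \<in> P"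
    interpret I: ideal I R by fact
    interpret J: ideal J R by fact
    show "I \<subseteq> P \<or> J \<subseteq> P"
    proof (rule ccontr)
      assume "\<not> (I \<subseteq> P \<or> J \<subseteq> P)"
      then obtain m n where "f m \<in> P <+>\<^bsub>R\<^esub> I" "f n \<in> P <+>\<^bsub>R\<^esub> J"
        using grow IJ by blast
      then have "f (max m n) \<in> P <+>\<^bsub>R\<^esub> I" "f (max m n) \<in> P <+>\<^bsub>R\<^esub> J"
        using up add_ideals P IJ by auto
      then obtain p i q j where pi: "p \<in> P" "i \<in> I" "q \<in> P" "j \<in> J"
        and eq: "f (max m n) = p \<oplus> i" "f (max m n) = q \<oplus> j"
        unfolding set_add_def' by blast
      let ?r = "r (f (max m n))"
      have r': "?r \<in> carrier R"
        using r fc by blast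
      have c: "p \<in> carrier R" "i \<in> carrier R" "q \<in> carrier R" "j \<in> carrier R"
        using pi by auto
      \<comment> \<open>The common term is used in both of its decompositions, one on each side of
        \<open>?r\<close>. In the expansion the summands with \<open>p\<close> or \<open>q\<close>
        lie in \<open>P\<close> anyway; only i r j needs the assumption on products of
        \<open>I\<close> and \<open>J\<close>.\<close>
      have "f (Suc (max m n)) = (p \<oplus> i) \<otimes> ?r \<otimes> (q \<oplus> j)"
        using fS[of "max m n"] eq by metis
      also have "\<dots> = p \<otimes> (?r \<otimes> (q \<oplus> j)) \<oplus> (i \<otimes> ?r \<otimes> q \<oplus> i \<otimes> ?r \<otimes> j)"
        using c r' by (simp add: l_distr r_distr m_assoc a_ac)
      also have "\<dots> \<in> P"
      proof -
        have "p \<otimes> (?r \<otimes> (q \<oplus> j)) \<in> P" "i \<otimes> ?r \<otimes> q \<in> P"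
          using pi(1,3) c r' P.I_r_closed P.I_l_closed by simp_all
        moreover have "i \<otimes> ?r \<otimes> j \<in> P"
          using IJ(3) pi r' I.I_r_closed by blast
        ultimately show ?thesis
          by simp
      qed
      finally show False
        using P(2) by blast
    qed
  qed (fact P(1))
  moreover have "x \<notin> P"
    using P(2) f0 by (metis disjoint_iff rangeI)
  ultimately show ?thesis
    by blast
qed

text \<open>A square-zero ideal lies in every prime. Conversely, if only the zero ideal squares to
  zero, every nonzero element is avoided by some prime.\<close>

lemma semiprime_ring_iff:
  "semiprime_ring R \<longleftrightarrow>
    (\<forall>I. ideal I R \<longrightarrow> (\<forall>x\<in>I. \<forall>y\<in>I. x \<otimes> y = \<zero>) \<longrightarrow> I = {\<zero>})" (is "_ \<longleftrightarrow> ?R")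
proof
  assume R: "semiprime_ring R"
  show ?R
  proof (intro allI impI)
    fix I assume I: "ideal I R" "\<forall>x\<in>I. \<forall>y\<in>I. x \<otimes> y = \<zero>"
    interpret I: ideal I R by fact
    have "I \<subseteq> P" if "prime_ideal R P" for P
      using prime_idealD[OF that I(1) I(1)] I(2)
        additive_subgroup.zero_closed[OF ideal.axioms(1)[OF prime_ideal_ideal[OF that]]]
      by auto
    then have "I \<subseteq> {x \<in> carrier R. \<forall>P. prime_ideal R P \<longrightarrow> x \<in> P}"
      using I.a_subset by blast
    then show "I = {\<zero>}"
      using R I.zero_closed unfolding semiprime_ring_def by blast
  qed
next
  assume R: ?R
  have "x = \<zero>" if "x \<in> carrier R" "\<forall>P. prime_ideal R P \<longrightarrow> x \<in> P" for x
    using exists_prime_avoiding[of x] R that by blast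
  moreover have "\<zero> \<in> P" if "prime_ideal R P" for P
    using additive_subgroup.zero_closed[OF ideal.axioms(1)[OF prime_ideal_ideal[OF that]]] .
  ultimately show "semiprime_ring R"
    using ring_axioms by (auto simp: semiprime_ring_def)
qed

text \<open>If \<open>I\<close> escapes \<open>P\<close> and \<open>J\<close> escapes
  \<open>Q\<close>, the smaller of \<open>P\<close> and \<open>Q\<close> contains neither, against
  its primeness.\<close>

lemma prime_ideal_chain_Inter:
  assumes "C \<noteq> {}" "\<And>P. P \<in> C \<Longrightarrow> prime_ideal R P"
    and chain: "\<And>P Q. P \<in> C \<Longrightarrow> Q \<in> C \<Longrightarrow> P \<subseteq> Q \<or> Q \<subseteq> P"
  shows "prime_ideal R (\<Inter>C)"
  unfolding prime_ideal_iff
proof (intro conjI allI impI)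
  show "ideal (\<Inter>C) R"
    using assms prime_ideal_ideal by (intro i_Intersect) auto
  obtain P where P: "P \<in> C"
    using assms(1) by blast
  then show "\<Inter>C \<noteq> carrier R"
    using prime_ideal_proper[OF assms(2)[OF P]] by blast
  fix I J assume IJ: "ideal I R" "ideal J R" "\<forall>i\<in>I. \<forall>j\<in>J. i \<otimes> j \<in> \<Inter>C"
  show "I \<subseteq> \<Inter>C \<or> J \<subseteq> \<Inter>C"
  proof (rule ccontr)
    assume "\<not> ?thesis"
    then obtain P Q where PQ: "P \<in> C" "\<not> I \<subseteq> P" "Q \<in> C" "\<not> J \<subseteq> Q"
      by blast
    have "I \<subseteq> P \<or> J \<subseteq> P" "I \<subseteq> Q \<or> J \<subseteq> Q"
      using prime_idealD[OF assms(2) IJ(1,2)] IJ(3) PQ by blast+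
    then show False
      using chain PQ by blast
  qed
qed

lemma exists_min_prime:
  assumes "prime_ideal R P"
  obtains Q where "Q \<in> min_primes R" "Q \<subseteq> P"
proof -
  \<comment> \<open>Complements turn minimal primes into maximal sets, the form in which Zorn's
    lemma is available; unions of chains become complements of intersections.\<close>
  let ?A = "{carrier R - Q |Q. prime_ideal R Q \<and> Q \<subseteq> P}"
  have "\<exists>M\<in>?A. \<forall>X\<in>?A. M \<subseteq> X \<longrightarrow> X = M"
  proof (rule subset_Zorn_nonempty)
    show "?A \<noteq> {}"
      using assms by blast
    fix C assume C: "C \<noteq> {}" "subset.chain ?A C"
    define D where "D = {Q. prime_ideal R Q \<and> Q \<subseteq> P \<and> carrier R - Q \<in> C}"
    have "C \<subseteq> ?A"
      using C(2) by (simp add: subset_chain_def)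
    then have CD: "C = (\<lambda>Q. carrier R - Q) ` D"
      unfolding D_def by blast
    with C(1) have "D \<noteq> {}"
      by blast
    moreover have "prime_ideal R Q \<and> Q \<subseteq> P" if "Q \<in> D" for Q
      using that by (simp add: D_def)
    ultimately have D: "D \<noteq> {}" "\<And>Q. Q \<in> D \<Longrightarrow> prime_ideal R Q \<and> Q \<subseteq> P"
      by blast+
    have "prime_ideal R (\<Inter>D)"
    proof (rule prime_ideal_chain_Inter)
      show "Q \<subseteq> Q' \<or> Q' \<subseteq> Q" if "Q \<in> D" "Q' \<in> D" for Q Q'
      proof -
        have "carrier R - Q \<subseteq> carrier R - Q' \<or> carrier R - Q' \<subseteq> carrier R - Q"
          using C(2) that by (simp add: subset_chain_def D_def)
        moreover have "Q \<subseteq> carrier R" "Q' \<subseteq> carrier R"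
          using D(2) that prime_ideal_proper by blast+
        ultimately show ?thesis
          by blast
      qed
    qed (use D in blast)+
    moreover have "\<Inter>D \<subseteq> P"
      using D by blast
    moreover have "\<Union>C = carrier R - \<Inter>D"
      using CD by blast
    ultimately show "\<Union>C \<in> ?A"
      by blast
  qed
  then obtain M where "M \<in> ?A" and max: "\<forall>X\<in>?A. M \<subseteq> X \<longrightarrow> X = M" ..
  then obtain Q where Q: "prime_ideal R Q" "Q \<subseteq> P" and M: "M = carrier R - Q"
    by blast
  have "Q' = Q" if "prime_ideal R Q'" "Q' \<subseteq> Q" for Q'
  proof -
    have "carrier R - Q' = carrier R - Q"
    proof -
      have "carrier R - Q' \<in> ?A" "M \<subseteq> carrier R - Q'"
        using that Q(2) M by blast+
      then show ?thesis
        using max M by simp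
    qed
    then show ?thesis
      using that(2) prime_ideal_proper[OF Q(1)] by blast
  qed
  then show ?thesis
    using that Q by (auto simp: min_primes_def)
qed

lemma semiprime_Inter_min_primes:
  assumes "semiprime_ring R" "x \<in> carrier R" "\<And>P. P \<in> min_primes R \<Longrightarrow> x \<in> P"
  shows "x = \<zero>"
proof -
  have "x \<in> P" if "prime_ideal R P" for P
    using exists_min_prime[OF that] assms(3) by blast
  then show ?thesis
    using assms(1,2) unfolding semiprime_ring_def by blast
qed

text \<open>A product of two ideals lies in their intersection, so primeness splits off one member
  of \<open>F\<close> at a time. The empty intersection is the whole ring, which a proper
  \<open>P\<close> cannot contain.\<close>

lemma prime_ideal_finite_Inter:
  assumes "prime_ideal R P" "finite F" "\<And>I. I \<in> F \<Longrightarrow> ideal I R" "carrier R \<inter> \<Inter>F \<subseteq> P"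
  shows "\<exists>I\<in>F. I \<subseteq> P"
  using assms(2-4)
proof (induction F rule: finite_induct)
  case empty
  then show ?case
    using prime_ideal_proper[OF assms(1)] by auto
next
  case (insert I F)
  let ?J = "carrier R \<inter> \<Inter>F"
  have I: "ideal I R" and J: "ideal ?J R"
    using insert.prems by (auto intro: ideal_Inter_carrier)
  have "i \<otimes> j \<in> P" if "i \<in> I" "j \<in> ?J" for i j
    using that ideal.I_r_closed[OF I, of i j] ideal.I_l_closed[OF J, of j i]
      ideal.Icarr[OF I, of i] insert.prems(2) by blast
  from prime_idealD[OF assms(1) I J this] show ?case
    using insert by auto
qed

end

section \<open>Localization at a regular left Ore set\<close>

locale regular_left_ore = ring R for R (structure) +
  fixes S
  assumes S_carrier: "S \<subseteq> carrier R"
    and S_mult: "\<lbrakk>s \<in> S; t \<in> S\<rbrakk> \<Longrightarrow> s \<otimes> t \<in> S"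
    and S_one: "\<one> \<in> S"
    and S_nonzero: "\<zero> \<notin> S"
    and ore: "\<lbrakk>r \<in> carrier R; s \<in> S\<rbrakk> \<Longrightarrow> \<exists>u\<in>S. \<exists>a\<in>carrier R. u \<otimes> r = a \<otimes> s"
    and left_regular: "\<lbrakk>s \<in> S; r \<in> carrier R; s \<otimes> r = \<zero>\<rbrakk> \<Longrightarrow> r = \<zero>"
    and right_regular: "\<lbrakk>s \<in> S; r \<in> carrier R; r \<otimes> s = \<zero>\<rbrakk> \<Longrightarrow> r = \<zero>"
begin

lemma S_in_carrier [simp]: "s \<in> S \<Longrightarrow> s \<in> carrier R"
  using S_carrier by blast

lemma right_cancel:
  assumes "s \<in> S" "a \<in> carrier R" "b \<in> carrier R" "a \<otimes> s = b \<otimes> s"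
  shows "a = b"
proof -
  have "(a \<ominus> b) \<otimes> s = \<zero>"
    using assms by (simp add: l_distr l_minus r_neg minus_eq)
  then have "a \<ominus> b = \<zero>"
    using assms right_regular by simp
  then show ?thesis
    using assms  by (metis a_inv_closed minus_eq minus_equality minus_minus)
qed

end

text \<open>Zero \<open>ass_l\<close> is left regularity of \<open>S\<close>. Given that, the
  denominator condition turns r s = 0 into t r = 0 and hence r = 0, so it becomes right
  regularity.\<close>

lemma Den_l_zero_iff_regular_left_ore:
  assumes "ring R"
  shows "S \<in> Den_l R {\<zero>\<^bsub>R\<^esub>} \<longleftrightarrow> regular_left_ore R S"
proof -
  interpret ring R by fact
  show ?thesis
  proof
    assume "S \<in> Den_l R {\<zero>\<^bsub>R\<^esub>}"
    then have d: "left_ore_set R S" "multiplicative_subset R S"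
      and r: "\<forall>r\<in>carrier R. \<forall>s\<in>S. r \<otimes>\<^bsub>R\<^esub> s = \<zero>\<^bsub>R\<^esub> \<longrightarrow> (\<exists>t\<in>S. t \<otimes>\<^bsub>R\<^esub> r = \<zero>\<^bsub>R\<^esub>)"
      and l: "ass_l R S = {\<zero>\<^bsub>R\<^esub>}"
      by (auto simp: Den_l_def left_denominator_set_def left_ore_set_def)
    have reg: "r = \<zero>\<^bsub>R\<^esub>" if "s \<in> S" "r \<in> carrier R" "s \<otimes>\<^bsub>R\<^esub> r = \<zero>\<^bsub>R\<^esub>" for r s
      using l that unfolding ass_l_def by blast
    show "regular_left_ore R S"
    proof (unfold_locales)
      show "\<exists>u\<in>S. \<exists>a\<in>carrier R. u \<otimes>\<^bsub>R\<^esub> r = a \<otimes>\<^bsub>R\<^esub> s" if "r \<in> carrier R" "s \<in> S" for r s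
        using d(1) that unfolding left_ore_set_def by fastforce
      show "r = \<zero>\<^bsub>R\<^esub>" if "s \<in> S" "r \<in> carrier R" "r \<otimes>\<^bsub>R\<^esub> s = \<zero>\<^bsub>R\<^esub>" for r s
        using r reg that by blast
    qed (use d(2) reg in \<open>auto simp: multiplicative_subset_def\<close>)
  next
    assume "regular_left_ore R S"
    then interpret regular_left_ore R S .
    have "left_ore_set R S"
      unfolding left_ore_set_def multiplicative_subset_def
    proof (intro conjI ballI)
      fix r s assume "r \<in> carrier R" "s \<in> S"
      then obtain u a where "u \<in> S" "a \<in> carrier R" "u \<otimes>\<^bsub>R\<^esub> r = a \<otimes>\<^bsub>R\<^esub> s"
        using ore by blast
      then show "{t \<otimes>\<^bsub>R\<^esub> r |t. t \<in> S} \<inter> {x \<otimes>\<^bsub>R\<^esub> s |x. x \<in> carrier R} \<noteq> {}"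
        by blast
    qed (use S_mult S_one S_nonzero S_carrier in auto)
    moreover have "ass_l R S = {\<zero>\<^bsub>R\<^esub>}"
      using left_regular S_one by (auto simp: ass_l_def)
    moreover have "\<exists>t\<in>S. t \<otimes>\<^bsub>R\<^esub> r = \<zero>\<^bsub>R\<^esub>"
      if "r \<in> carrier R" "s \<in> S" "r \<otimes>\<^bsub>R\<^esub> s = \<zero>\<^bsub>R\<^esub>" for r s
      using right_regular[OF that(2,1,3)] S_one by auto
    ultimately show "S \<in> Den_l R {\<zero>\<^bsub>R\<^esub>}"
      by (auto simp: Den_l_def left_denominator_set_def)
  qed
qed

section \<open>Equality and addition of fractions over a torsion-free module\<close>

lemma mem_lfrac_add_iff:
  "p \<in> lfrac_add R S M X Y \<longleftrightarrow> (\<exists>s x t y u a. (s, x) \<in> X \<and> (t, y) \<in> Y \<and> u \<in> S \<and>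
    a \<in> carrier R \<and> u \<otimes>\<^bsub>R\<^esub> s = a \<otimes>\<^bsub>R\<^esub> t \<and>
    p \<in> lfrac R S M (u \<otimes>\<^bsub>R\<^esub> s) (u \<odot>\<^bsub>M\<^esub> x \<oplus>\<^bsub>M\<^esub> a \<odot>\<^bsub>M\<^esub> y))"
  unfolding lfrac_add_def by (simp add: case_prod_beta Bex_def cong: conj_cong)

lemma lfrac_relI:
  assumes "s \<in> S" "t \<in> S" "x \<in> carrier M" "y \<in> carrier M" "a \<in> carrier R" "b \<in> carrier R"
    and "a \<otimes>\<^bsub>R\<^esub> s = b \<otimes>\<^bsub>R\<^esub> t" "a \<otimes>\<^bsub>R\<^esub> s \<in> S" "a \<odot>\<^bsub>M\<^esub> x = b \<odot>\<^bsub>M\<^esub> y"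
  shows "((s, x), (t, y)) \<in> lfrac_rel R S M"
  using assms unfolding lfrac_rel_def by blast

text \<open>\<open>S\<close> acts injectively on \<open>M\<close>. This holds for \<open>R\<close>
  itself and for quotients by saturated ideals, so the fractions of both are treated at
  once.\<close>

locale torsion_free_module = left_module R M + regular_left_ore R S
  for R (structure) and M (structure) and S +
  assumes torsion_free: "\<lbrakk>s \<in> S; x \<in> carrier M; s \<odot>\<^bsub>M\<^esub> x = \<zero>\<^bsub>M\<^esub>\<rbrakk> \<Longrightarrow> x = \<zero>\<^bsub>M\<^esub>"
begin

declare smult_closed [simp]

lemma smult_zero [simp]:
  assumes "a \<in> carrier R"
  shows "a \<odot>\<^bsub>M\<^esub> \<zero>\<^bsub>M\<^esub> = \<zero>\<^bsub>M\<^esub>"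
proof -
  have "a \<odot>\<^bsub>M\<^esub> \<zero>\<^bsub>M\<^esub> \<oplus>\<^bsub>M\<^esub> a \<odot>\<^bsub>M\<^esub> \<zero>\<^bsub>M\<^esub> = a \<odot>\<^bsub>M\<^esub> \<zero>\<^bsub>M\<^esub> \<oplus>\<^bsub>M\<^esub> \<zero>\<^bsub>M\<^esub>"
    using assms smult_r_distr[of a "\<zero>\<^bsub>M\<^esub>" "\<zero>\<^bsub>M\<^esub>"] by simp
  then show ?thesis
    using assms by (simp del: M.r_zero)
qed

lemma smult_minus:
  assumes "a \<in> carrier R" "x \<in> carrier M"
  shows "a \<odot>\<^bsub>M\<^esub> (\<ominus>\<^bsub>M\<^esub> x) = \<ominus>\<^bsub>M\<^esub> (a \<odot>\<^bsub>M\<^esub> x)"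
proof -
  have "a \<odot>\<^bsub>M\<^esub> (\<ominus>\<^bsub>M\<^esub> x) \<oplus>\<^bsub>M\<^esub> a \<odot>\<^bsub>M\<^esub> x = \<zero>\<^bsub>M\<^esub>"
    using assms by (simp add: smult_r_distr[symmetric] M.l_neg)
  then show ?thesis
    using assms by (simp add: M.minus_equality)
qed

lemma smult_cancel:
  assumes "s \<in> S" "x \<in> carrier M" "y \<in> carrier M" "s \<odot>\<^bsub>M\<^esub> x = s \<odot>\<^bsub>M\<^esub> y"
  shows "x = y"
proof -
  have "s \<odot>\<^bsub>M\<^esub> (x \<oplus>\<^bsub>M\<^esub> \<ominus>\<^bsub>M\<^esub> y) = \<zero>\<^bsub>M\<^esub>"
    using assms by (simp add: smult_r_distr smult_minus M.r_neg)
  then have "x \<oplus>\<^bsub>M\<^esub> \<ominus>\<^bsub>M\<^esub> y = \<zero>\<^bsub>M\<^esub>"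
    using assms torsion_free by simp
  then show ?thesis
    using assms by (metis M.a_inv_closed M.minus_equality M.minus_minus)
qed

text \<open>Since \<open>S\<close> is regular and \<open>M\<close> torsion free, one pair of multipliers that witnesses
  the equality of two fractions forces the corresponding identity for all pairs.\<close>

lemma lfrac_rel_iff:
  "((s, x), (t, y)) \<in> lfrac_rel R S M \<longleftrightarrow>
    s \<in> S \<and> t \<in> S \<and> x \<in> carrier M \<and> y \<in> carrier M \<and>
    (\<forall>c\<in>carrier R. \<forall>d\<in>carrier R. c \<otimes> s = d \<otimes> t \<longrightarrow> c \<odot>\<^bsub>M\<^esub> x = d \<odot>\<^bsub>M\<^esub> y)"
    (is "?L \<longleftrightarrow> ?R")
proof
  assume ?L
  then obtain a b where st: "s \<in> S" "t \<in> S" and xy: "x \<in> carrier M" "y \<in> carrier M"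
    and ab: "a \<in> carrier R" "b \<in> carrier R" "a \<otimes> s = b \<otimes> t" "a \<otimes> s \<in> S"
      "a \<odot>\<^bsub>M\<^esub> x = b \<odot>\<^bsub>M\<^esub> y"
    by (auto simp: lfrac_rel_def)
  have "c \<odot>\<^bsub>M\<^esub> x = d \<odot>\<^bsub>M\<^esub> y"
    if cd: "c \<in> carrier R" "d \<in> carrier R" "c \<otimes> s = d \<otimes> t" for c d
  proof -
    \<comment> \<open>An Ore step makes the denominators c s and a s comparable. Cancelling s and t
      on the right gives f c = e a and f d = e b; these carry the known identity for a, b over to c,
      d up to the factor f, which torsion-freeness removes.\<close>
    obtain f e where fe: "f \<in> S" "e \<in> carrier R" "f \<otimes> (c \<otimes> s) = e \<otimes> (a \<otimes> s)"
      using ore[of "c \<otimes> s" "a \<otimes> s"] ab st cd by auto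
    have "(f \<otimes> c) \<otimes> s = (e \<otimes> a) \<otimes> s"
      using fe ab st cd by (simp add: m_assoc)
    from right_cancel[OF st(1) _ _ this] have 1: "f \<otimes> c = e \<otimes> a"
      using fe(1,2) ab(1) cd(1) by simp
    have "(f \<otimes> d) \<otimes> t = (e \<otimes> b) \<otimes> t"
      using fe ab st cd by (simp add: m_assoc)
    from right_cancel[OF st(2) _ _ this] have 2: "f \<otimes> d = e \<otimes> b"
      using fe(1,2) ab(2) cd(2) by simp
    have "f \<odot>\<^bsub>M\<^esub> (c \<odot>\<^bsub>M\<^esub> x) = e \<odot>\<^bsub>M\<^esub> (a \<odot>\<^bsub>M\<^esub> x)"
      using fe(1,2) ab(1,2) cd(1,2) xy 1 by (simp add: smult_assoc1[symmetric])
    also have "\<dots> = f \<odot>\<^bsub>M\<^esub> (d \<odot>\<^bsub>M\<^esub> y)"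
      using fe(1,2) ab(1,2,5) cd(1,2) xy 2 by (simp add: smult_assoc1[symmetric])
    finally show ?thesis
      using fe cd xy smult_cancel by simp
  qed
  then show ?R
    using st xy by blast
next
  assume R: ?R
  then obtain u a where "u \<in> S" "a \<in> carrier R" "u \<otimes> s = a \<otimes> t"
    using ore[of s t] by auto
  then show ?L
    using R S_mult[of u s] by (intro lfrac_relI[where a = u and b = a]) auto
qed

lemma equiv_lfrac_rel: "equiv (S \<times> carrier M) (lfrac_rel R S M)"
proof (rule equivI)
  show "lfrac_rel R S M \<subseteq> (S \<times> carrier M) \<times> (S \<times> carrier M)"
    by (auto simp: lfrac_rel_def)
  show "refl_on (S \<times> carrier M) (lfrac_rel R S M)"
  proof (rule refl_onI, clarify)
    fix s x assume "s \<in> S" "x \<in> carrier M"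
    then show "((s, x), (s, x)) \<in> lfrac_rel R S M"
      using right_cancel by (metis lfrac_rel_iff)
  qed
  show "sym (lfrac_rel R S M)"
    by (rule symI) (clarsimp simp: lfrac_rel_iff)
  show "trans (lfrac_rel R S M)"
  proof (rule transI, clarify)
    fix s x t y w z
    assume 1: "((s, x), (t, y)) \<in> lfrac_rel R S M" and 2: "((t, y), (w, z)) \<in> lfrac_rel R S M"
    then have m: "s \<in> S" "t \<in> S" "w \<in> S" "x \<in> carrier M" "y \<in> carrier M" "z \<in> carrier M"
      by (auto simp: lfrac_rel_iff)
    \<comment> \<open>Two Ore steps, first over t and then over w, give the multipliers v u and b.
      The resulting denominator is in \<open>S\<close> because v and u s are, although b need not
      be.\<close>
    obtain u a where ua: "u \<in> S" "a \<in> carrier R" "u \<otimes> s = a \<otimes> t"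
      using ore[of s t] m by auto
    obtain v b where vb: "v \<in> S" "b \<in> carrier R" "v \<otimes> (a \<otimes> t) = b \<otimes> w"
      using ore[of "a \<otimes> t" w] m ua by auto
    have "u \<odot>\<^bsub>M\<^esub> x = a \<odot>\<^bsub>M\<^esub> y"
      using 1 m ua by (simp add: lfrac_rel_iff)
    moreover have "(v \<otimes> a) \<odot>\<^bsub>M\<^esub> y = b \<odot>\<^bsub>M\<^esub> z"
      using 2 m ua vb by (simp add: lfrac_rel_iff m_assoc)
    ultimately have "(v \<otimes> u) \<odot>\<^bsub>M\<^esub> x = b \<odot>\<^bsub>M\<^esub> z"
      using m ua vb by (simp add: smult_assoc1)
    moreover have "(v \<otimes> u) \<otimes> s = b \<otimes> w" "(v \<otimes> u) \<otimes> s \<in> S"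
      using m ua vb S_mult[of v "u \<otimes> s"] S_mult[of u s] by (simp_all add: m_assoc)
    ultimately show "((s, x), (w, z)) \<in> lfrac_rel R S M"
      using m ua(1,2) vb(1,2) by (intro lfrac_relI[where a = "v \<otimes> u" and b = b]) auto
  qed
qed

lemma lfrac_eq_iff:
  assumes "s \<in> S" "t \<in> S" "x \<in> carrier M" "y \<in> carrier M"
  shows "lfrac R S M s x = lfrac R S M t y \<longleftrightarrow>
    (\<forall>c\<in>carrier R. \<forall>d\<in>carrier R. c \<otimes> s = d \<otimes> t \<longrightarrow> c \<odot>\<^bsub>M\<^esub> x = d \<odot>\<^bsub>M\<^esub> y)"
  using assms equiv_lfrac_rel by (simp add: lfrac_def eq_equiv_class_iff lfrac_rel_iff)

lemma lfrac_eqI: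
  assumes "s \<in> S" "t \<in> S" "x \<in> carrier M" "y \<in> carrier M" "a \<in> carrier R" "b \<in> carrier R"
    and "a \<otimes> s = b \<otimes> t" "a \<otimes> s \<in> S" "a \<odot>\<^bsub>M\<^esub> x = b \<odot>\<^bsub>M\<^esub> y"
  shows "lfrac R S M s x = lfrac R S M t y"
  unfolding lfrac_def using assms by (intro equiv_class_eq[OF equiv_lfrac_rel] lfrac_relI)

lemma mem_lfrac_iff:
  assumes "s \<in> S" "x \<in> carrier M"
  shows "(t, y) \<in> lfrac R S M s x \<longleftrightarrow>
    t \<in> S \<and> y \<in> carrier M \<and> lfrac R S M t y = lfrac R S M s x"
  using assms lfrac_eq_iff[of s t x y] by (auto simp: lfrac_def lfrac_rel_iff)

lemma lfrac_expand:
  assumes "s \<in> S" "x \<in> carrier M" "a \<in> carrier R" "a \<otimes> s \<in> S"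
  shows "lfrac R S M (a \<otimes> s) (a \<odot>\<^bsub>M\<^esub> x) = lfrac R S M s x"
  using assms by (intro lfrac_eqI[where a = \<one> and b = a]) (auto simp: smult_one)

lemma common_denominator:
  assumes "s \<in> S" "x \<in> carrier M" "t \<in> S"
  obtains u a where "u \<in> S" "u \<otimes> s \<in> S" "a \<in> carrier R" "u \<otimes> s = a \<otimes> t"
    "lfrac R S M s x = lfrac R S M (a \<otimes> t) (u \<odot>\<^bsub>M\<^esub> x)"
proof -
  obtain u a where ua: "u \<in> S" "a \<in> carrier R" "u \<otimes> s = a \<otimes> t"
    using ore[of s t] assms by auto
  moreover have "u \<otimes> s \<in> S"
    using ua(1) assms(1) by (rule S_mult)
  ultimately show ?thesis
    using assms lfrac_expand[of s x u] by (intro that) auto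
qed

text \<open>The union defining \<open>lfrac_add\<close> runs over all representatives and all Ore
  choices. Every contribution is the same class and at least one occurs, so the union is that class.
  Contributions are compared by one more Ore step on their denominators, after which both summands
  match separately.\<close>

lemma lfrac_add_lfrac_ore:
  assumes m: "s \<in> S" "t \<in> S" "x \<in> carrier M" "y \<in> carrier M"
    and ua: "u \<in> S" "a \<in> carrier R" "u \<otimes> s = a \<otimes> t"
  shows "lfrac_add R S M (lfrac R S M s x) (lfrac R S M t y) =
    lfrac R S M (u \<otimes> s) (u \<odot>\<^bsub>M\<^esub> x \<oplus>\<^bsub>M\<^esub> a \<odot>\<^bsub>M\<^esub> y)" (is "?L = ?R")
proof -
  have eq: "lfrac R S M (u' \<otimes> s') (u' \<odot>\<^bsub>M\<^esub> x' \<oplus>\<^bsub>M\<^esub> a' \<odot>\<^bsub>M\<^esub> y') = ?R"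
    if X: "(s', x') \<in> lfrac R S M s x" and Y: "(t', y') \<in> lfrac R S M t y"
      and ua': "u' \<in> S" "a' \<in> carrier R" "u' \<otimes> s' = a' \<otimes> t'" for s' x' t' y' u' a'
  proof -
    have m': "s' \<in> S" "t' \<in> S" "x' \<in> carrier M" "y' \<in> carrier M"
      using X Y m by (auto simp: mem_lfrac_iff)
    have e: "\<forall>c\<in>carrier R. \<forall>d\<in>carrier R. c \<otimes> s' = d \<otimes> s \<longrightarrow> c \<odot>\<^bsub>M\<^esub> x' = d \<odot>\<^bsub>M\<^esub> x"
      "\<forall>c\<in>carrier R. \<forall>d\<in>carrier R. c \<otimes> t' = d \<otimes> t \<longrightarrow> c \<odot>\<^bsub>M\<^esub> y' = d \<odot>\<^bsub>M\<^esub> y"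
      using X Y m m' by (auto simp: mem_lfrac_iff lfrac_eq_iff)
    have S: "u \<otimes> s \<in> S" "u' \<otimes> s' \<in> S"
      using m ua m' ua' S_mult by blast+
    then obtain c d where cd: "c \<in> S" "d \<in> carrier R" "c \<otimes> (u' \<otimes> s') = d \<otimes> (u \<otimes> s)"
      using ore[of "u' \<otimes> s'" "u \<otimes> s"] by auto
    have "(c \<otimes> u') \<odot>\<^bsub>M\<^esub> x' = (d \<otimes> u) \<odot>\<^bsub>M\<^esub> x"
      using e(1) m ua m' ua' cd by (simp add: m_assoc)
    moreover have "(c \<otimes> a') \<odot>\<^bsub>M\<^esub> y' = (d \<otimes> a) \<odot>\<^bsub>M\<^esub> y"
      using e(2) m ua m' ua' cd by (simp add: m_assoc)
    ultimately have "c \<odot>\<^bsub>M\<^esub> (u' \<odot>\<^bsub>M\<^esub> x' \<oplus>\<^bsub>M\<^esub> a' \<odot>\<^bsub>M\<^esub> y') = d \<odot>\<^bsub>M\<^esub> (u \<odot>\<^bsub>M\<^esub> x \<oplus>\<^bsub>M\<^esub> a \<odot>\<^bsub>M\<^esub> y)"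
      using m ua m' ua' cd by (simp add: smult_r_distr smult_assoc1)
    then show ?thesis
      using S S_mult[OF cd(1) S(2)] cd m m' ua ua'
      by (intro lfrac_eqI[where a = c and b = d]) auto
  qed
  have "(s, x) \<in> lfrac R S M s x" "(t, y) \<in> lfrac R S M t y"
    using m by (auto simp: mem_lfrac_iff)
  then have "p \<in> ?L \<longleftrightarrow> p \<in> ?R" for p
    unfolding mem_lfrac_add_iff using ua eq by blast
  then show ?thesis
    by blast
qed

lemma lfrac_add_lfrac [simp]:
  assumes "s \<in> S" "x \<in> carrier M" "y \<in> carrier M"
  shows "lfrac_add R S M (lfrac R S M s x) (lfrac R S M s y) = lfrac R S M s (x \<oplus>\<^bsub>M\<^esub> y)"
  using lfrac_add_lfrac_ore[of s s x y \<one> \<one>] assms S_one by (simp add: smult_one)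

lemma loc_module_sel [simp]:
  "add (loc_module R S M) = lfrac_add R S M"
  "zero (loc_module R S M) = lfrac R S M \<one> \<zero>\<^bsub>M\<^esub>"
  "smult (loc_module R S M) = lfrac_smult R S M"
  by (auto simp: loc_module_def)

lemma lfrac_in_loc_module [simp]:
  "\<lbrakk>s \<in> S; x \<in> carrier M\<rbrakk> \<Longrightarrow> lfrac R S M s x \<in> carrier (loc_module R S M)"
  by (auto simp: loc_module_def)

lemma loc_module_cases:
  assumes "X \<in> carrier (loc_module R S M)"
  obtains s x where "s \<in> S" "x \<in> carrier M" "X = lfrac R S M s x"
  using assms by (auto simp: loc_module_def)

text \<open>Over a shared denominator \<open>lfrac_add_lfrac\<close> adds numerators only, so each
  group law reduces to the same law in \<open>M\<close>. Associativity needs the variant for three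
  classes.\<close>

lemma loc_module_cases2:
  assumes "X \<in> carrier (loc_module R S M)" "Y \<in> carrier (loc_module R S M)"
  obtains s x y where "s \<in> S" "x \<in> carrier M" "y \<in> carrier M"
    "X = lfrac R S M s x" "Y = lfrac R S M s y"
proof -
  obtain s x t y where *: "s \<in> S" "x \<in> carrier M" "X = lfrac R S M s x"
      "t \<in> S" "y \<in> carrier M" "Y = lfrac R S M t y"
    using assms by (metis loc_module_cases)
  obtain u a where ua: "u \<in> S" "u \<otimes> s \<in> S" "a \<in> carrier R" "u \<otimes> s = a \<otimes> t"
      "lfrac R S M s x = lfrac R S M (a \<otimes> t) (u \<odot>\<^bsub>M\<^esub> x)"
    using common_denominator[of s x t] * by metis
  then have "Y = lfrac R S M (a \<otimes> t) (a \<odot>\<^bsub>M\<^esub> y)"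
    using * by (simp add: lfrac_expand)
  then show ?thesis
    using * ua by (intro that[of "a \<otimes> t" "u \<odot>\<^bsub>M\<^esub> x" "a \<odot>\<^bsub>M\<^esub> y"]) auto
qed

lemma loc_module_cases3:
  assumes "X \<in> carrier (loc_module R S M)" "Y \<in> carrier (loc_module R S M)"
    "Z \<in> carrier (loc_module R S M)"
  obtains s x y z where "s \<in> S" "x \<in> carrier M" "y \<in> carrier M" "z \<in> carrier M"
    "X = lfrac R S M s x" "Y = lfrac R S M s y" "Z = lfrac R S M s z"
proof -
  obtain s x y t z where *: "s \<in> S" "x \<in> carrier M" "X = lfrac R S M s x"
      "y \<in> carrier M" "Y = lfrac R S M s y" "t \<in> S" "z \<in> carrier M" "Z = lfrac R S M t z"
    using assms by (metis loc_module_cases loc_module_cases2)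
  obtain u a where ua: "u \<in> S" "u \<otimes> t \<in> S" "a \<in> carrier R" "u \<otimes> t = a \<otimes> s"
      "lfrac R S M t z = lfrac R S M (a \<otimes> s) (u \<odot>\<^bsub>M\<^esub> z)"
    using common_denominator[of t z s] * by metis
  then have "X = lfrac R S M (a \<otimes> s) (a \<odot>\<^bsub>M\<^esub> x)" "Y = lfrac R S M (a \<otimes> s) (a \<odot>\<^bsub>M\<^esub> y)"
    using * by (simp_all add: lfrac_expand)
  then show ?thesis
    using * ua by (intro that[of "a \<otimes> s" "a \<odot>\<^bsub>M\<^esub> x" "a \<odot>\<^bsub>M\<^esub> y" "u \<odot>\<^bsub>M\<^esub> z"]) auto
qed

text \<open>The multipliers 1 and s for the denominators s and 1 turn equality with zero into 1 x =
  s 0. This computes all the kernels needed later.\<close>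

lemma lfrac_eq_zero_iff:
  assumes "s \<in> S" "x \<in> carrier M"
  shows "lfrac R S M s x = lfrac R S M \<one> \<zero>\<^bsub>M\<^esub> \<longleftrightarrow> x = \<zero>\<^bsub>M\<^esub>"
proof
  assume "lfrac R S M s x = lfrac R S M \<one> \<zero>\<^bsub>M\<^esub>"
  then have "\<one> \<odot>\<^bsub>M\<^esub> x = s \<odot>\<^bsub>M\<^esub> \<zero>\<^bsub>M\<^esub>"
    using assms S_one lfrac_eq_iff[of s \<one> x "\<zero>\<^bsub>M\<^esub>"] by simp
  then show "x = \<zero>\<^bsub>M\<^esub>"
    using assms by (simp add: smult_one)
next
  assume "x = \<zero>\<^bsub>M\<^esub>"
  then show "lfrac R S M s x = lfrac R S M \<one> \<zero>\<^bsub>M\<^esub>"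
    using assms S_one lfrac_expand[of \<one> "\<zero>\<^bsub>M\<^esub>" s] by simp
qed

lemma lfrac_zero: "s \<in> S \<Longrightarrow> lfrac R S M \<one> \<zero>\<^bsub>M\<^esub> = lfrac R S M s \<zero>\<^bsub>M\<^esub>"
  using lfrac_eq_zero_iff[of s "\<zero>\<^bsub>M\<^esub>"] by simp

lemma loc_module_abelian_group: "abelian_group (loc_module R S M)"
proof (rule abelian_groupI)
  show "X \<oplus>\<^bsub>loc_module R S M\<^esub> Y \<in> carrier (loc_module R S M)"
    if XY: "X \<in> carrier (loc_module R S M)" "Y \<in> carrier (loc_module R S M)" for X Y
    by (rule loc_module_cases2[OF XY]) simp
  show "\<zero>\<^bsub>loc_module R S M\<^esub> \<in> carrier (loc_module R S M)"
    using S_one by simp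
  show "X \<oplus>\<^bsub>loc_module R S M\<^esub> Y \<oplus>\<^bsub>loc_module R S M\<^esub> Z =
      X \<oplus>\<^bsub>loc_module R S M\<^esub> (Y \<oplus>\<^bsub>loc_module R S M\<^esub> Z)"
    if XYZ: "X \<in> carrier (loc_module R S M)" "Y \<in> carrier (loc_module R S M)"
      "Z \<in> carrier (loc_module R S M)" for X Y Z
    by (rule loc_module_cases3[OF XYZ]) (simp add: M.a_assoc)
  show "X \<oplus>\<^bsub>loc_module R S M\<^esub> Y = Y \<oplus>\<^bsub>loc_module R S M\<^esub> X"
    if XY: "X \<in> carrier (loc_module R S M)" "Y \<in> carrier (loc_module R S M)" for X Y
    by (rule loc_module_cases2[OF XY]) (simp add: M.a_comm)
  show "\<zero>\<^bsub>loc_module R S M\<^esub> \<oplus>\<^bsub>loc_module R S M\<^esub> X = X"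
    if X: "X \<in> carrier (loc_module R S M)" for X
    by (rule loc_module_cases[OF X]) (simp add: lfrac_zero)
  show "\<exists>Y\<in>carrier (loc_module R S M). Y \<oplus>\<^bsub>loc_module R S M\<^esub> X = \<zero>\<^bsub>loc_module R S M\<^esub>"
    if X: "X \<in> carrier (loc_module R S M)" for X
  proof (rule loc_module_cases[OF X])
    fix s x assume "s \<in> S" "x \<in> carrier M" "X = lfrac R S M s x"
    then show ?thesis
      by (intro bexI[of _ "lfrac R S M s (\<ominus>\<^bsub>M\<^esub> x)"]) (auto simp: M.l_neg lfrac_zero)
  qed
qed

end

section \<open>Multiplication of fractions, and the ring and module axioms\<close>

lemma regular_module_sel [simp]:
  "carrier (regular_module R) = carrier R"
  "add (regular_module R) = add R"
  "zero (regular_module R) = zero R"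
  "smult (regular_module R) = monoid.mult R"
  by (auto simp: regular_module_def)

text \<open>Carries additive structure between records of different types, such as a ring and its
  regular module, that share carrier, addition and zero.\<close>

lemma abelian_group_cong:
  assumes "abelian_group G" "carrier H = carrier G" "add H = add G" "zero H = zero G"
  shows "abelian_group H"
proof -
  interpret abelian_group G by fact
  show ?thesis
    using assms(2-4) l_neg
    by (intro abelian_groupI) (auto simp: a_ac intro!: bexI[of _ "\<ominus>\<^bsub>G\<^esub> x" for x])
qed

lemma (in ring) regular_left_module: "left_module R (regular_module R)"
proof -
  have "abelian_group (regular_module R)"
    using abelian_group_axioms by (rule abelian_group_cong) simp_all
  then show ?thesis
    using ring_axioms
    by (auto simp: left_module_def left_module_axioms_def l_distr r_distr m_assoc)
qed

lemma (in regular_left_ore) regular_torsion_free_module: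
  "torsion_free_module R (regular_module R) S"
  using regular_left_module regular_left_ore_axioms left_regular
  by (auto simp: torsion_free_module_def torsion_free_module_axioms_def)

text \<open>With \<open>R\<close> as a module over itself, arithmetic in \<open>loc_ring\<close>
  becomes a case of the module calculus, available under the prefix \<open>reg\<close>.\<close>

sublocale regular_left_ore \<subseteq> reg: torsion_free_module R "regular_module R" S
  by (rule regular_torsion_free_module)

lemma mem_lfrac_smult_iff:
  "p \<in> lfrac_smult R S M X Y \<longleftrightarrow> (\<exists>s r t y u a. (s, r) \<in> X \<and> (t, y) \<in> Y \<and> u \<in> S \<and>
    a \<in> carrier R \<and> u \<otimes>\<^bsub>R\<^esub> r = a \<otimes>\<^bsub>R\<^esub> t \<and> p \<in> lfrac R S M (u \<otimes>\<^bsub>R\<^esub> s) (a \<odot>\<^bsub>M\<^esub> y))"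
  unfolding lfrac_smult_def by (simp add: case_prod_beta Bex_def cong: conj_cong)

lemma loc_ring_sel [simp]:
  "carrier (loc_ring R S) = carrier (loc_module R S (regular_module R))"
  "add (loc_ring R S) = lfrac_add R S (regular_module R)"
  "zero (loc_ring R S) = lfrac R S (regular_module R) \<one>\<^bsub>R\<^esub> \<zero>\<^bsub>R\<^esub>"
  "one (loc_ring R S) = lfrac R S (regular_module R) \<one>\<^bsub>R\<^esub> \<one>\<^bsub>R\<^esub>"
  "monoid.mult (loc_ring R S) = lfrac_smult R S (regular_module R)"
  by (auto simp: loc_ring_def loc_module_def)

context torsion_free_module
begin

text \<open>Independence of choices passes through the left factor first: equality there gives (c
  u') r' = (d u) r, which the two Ore equations turn into (c a') t' = (d a) t. This is the
  hypothesis under which equality of the right factors identifies the numerators.\<close>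

lemma lfrac_smult_lfrac_ore:
  assumes m: "s \<in> S" "t \<in> S" "r \<in> carrier R" "y \<in> carrier M"
    and ua: "u \<in> S" "a \<in> carrier R" "u \<otimes> r = a \<otimes> t"
  shows "lfrac_smult R S M (lfrac R S (regular_module R) s r) (lfrac R S M t y) =
    lfrac R S M (u \<otimes> s) (a \<odot>\<^bsub>M\<^esub> y)" (is "?L = ?R")
proof -
  have eq: "lfrac R S M (u' \<otimes> s') (a' \<odot>\<^bsub>M\<^esub> y') = ?R"
    if X: "(s', r') \<in> lfrac R S (regular_module R) s r" and Y: "(t', y') \<in> lfrac R S M t y"
      and ua': "u' \<in> S" "a' \<in> carrier R" "u' \<otimes> r' = a' \<otimes> t'" for s' r' t' y' u' a'
  proof -
    have m': "s' \<in> S" "t' \<in> S" "r' \<in> carrier R" "y' \<in> carrier M"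
      using X Y m by (auto simp: mem_lfrac_iff reg.mem_lfrac_iff)
    have e: "\<forall>c\<in>carrier R. \<forall>d\<in>carrier R. c \<otimes> s' = d \<otimes> s \<longrightarrow> c \<otimes> r' = d \<otimes> r"
      "\<forall>c\<in>carrier R. \<forall>d\<in>carrier R. c \<otimes> t' = d \<otimes> t \<longrightarrow> c \<odot>\<^bsub>M\<^esub> y' = d \<odot>\<^bsub>M\<^esub> y"
      using X Y m m' by (auto simp: mem_lfrac_iff lfrac_eq_iff reg.mem_lfrac_iff reg.lfrac_eq_iff)
    have S: "u \<otimes> s \<in> S" "u' \<otimes> s' \<in> S"
      using m ua m' ua' S_mult by blast+
    then obtain c d where cd: "c \<in> S" "d \<in> carrier R" "c \<otimes> (u' \<otimes> s') = d \<otimes> (u \<otimes> s)"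
      using ore[of "u' \<otimes> s'" "u \<otimes> s"] by auto
    have "(c \<otimes> u') \<otimes> r' = (d \<otimes> u) \<otimes> r"
      using e(1)[rule_format, of "c \<otimes> u'" "d \<otimes> u"] m ua(1,2) m' ua'(1,2) cd
      by (simp add: m_assoc)
    then have "(c \<otimes> a') \<otimes> t' = (d \<otimes> a) \<otimes> t"
      using m ua m' ua' cd(1,2) by (simp add: m_assoc)
    then have "(c \<otimes> a') \<odot>\<^bsub>M\<^esub> y' = (d \<otimes> a) \<odot>\<^bsub>M\<^esub> y"
      using e(2) m ua(1,2) m' ua'(1,2) cd(1,2) by simp
    then have "c \<odot>\<^bsub>M\<^esub> (a' \<odot>\<^bsub>M\<^esub> y') = d \<odot>\<^bsub>M\<^esub> (a \<odot>\<^bsub>M\<^esub> y)"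
      using m ua(1,2) m' ua'(1,2) cd(1,2) by (simp add: smult_assoc1)
    then show ?thesis
      using S S_mult[OF cd(1) S(2)] cd m m' ua(1,2) ua'(1,2)
      by (intro lfrac_eqI[where a = c and b = d]) auto
  qed
  have "(s, r) \<in> lfrac R S (regular_module R) s r" "(t, y) \<in> lfrac R S M t y"
    using m by (auto simp: mem_lfrac_iff reg.mem_lfrac_iff)
  then have "p \<in> ?L \<longleftrightarrow> p \<in> ?R" for p
    unfolding mem_lfrac_smult_iff using ua eq by blast
  then show ?thesis
    by blast
qed

text \<open>\<open>s\<^sup>-\<^sup>1at \<cdot> t\<^sup>-\<^sup>1y = s\<^sup>-\<^sup>1ay\<close>: by the Ore condition every product can be
  brought into this shape.\<close>

lemma lfrac_smult_lfrac:
  assumes "s \<in> S" "t \<in> S" "a \<in> carrier R" "y \<in> carrier M"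
  shows "lfrac_smult R S M (lfrac R S (regular_module R) s (a \<otimes> t)) (lfrac R S M t y) =
    lfrac R S M s (a \<odot>\<^bsub>M\<^esub> y)"
  using lfrac_smult_lfrac_ore[of s t "a \<otimes> t" y \<one> a] assms S_one by simp

lemma lfrac_smult_integral:
  assumes "s \<in> S" "r \<in> carrier R" "y \<in> carrier M"
  shows "lfrac_smult R S M (lfrac R S (regular_module R) s r) (lfrac R S M \<one> y) =
    lfrac R S M s (r \<odot>\<^bsub>M\<^esub> y)"
  using lfrac_smult_lfrac[of s \<one> r y] assms S_one by simp

text \<open>An Ore step on the numerator makes it divisible by \<open>t\<close> on the right, so
  that it cancels against a following denominator \<open>t\<close>.\<close>

lemma lfrac_composable:
  assumes X: "X \<in> carrier (loc_ring R S)" and t: "t \<in> S"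
  obtains s a where "s \<in> S" "a \<in> carrier R" "X = lfrac R S (regular_module R) s (a \<otimes> t)"
proof -
  obtain s r where sr: "s \<in> S" "r \<in> carrier R" "X = lfrac R S (regular_module R) s r"
    using X by (auto elim: reg.loc_module_cases)
  then obtain u a where ua: "u \<in> S" "a \<in> carrier R" "u \<otimes> r = a \<otimes> t"
    using ore t by blast
  moreover have us: "u \<otimes> s \<in> S"
    using sr ua S_mult by blast
  ultimately have "X = lfrac R S (regular_module R) (u \<otimes> s) (a \<otimes> t)"
    using reg.lfrac_expand[of s r u] sr by simp
  then show ?thesis
    using ua us that by blast
qed

lemma smult_cases:
  assumes X: "X \<in> carrier (loc_ring R S)" and Y: "Y \<in> carrier (loc_module R S M)"
  obtains s a t y where "s \<in> S" "a \<in> carrier R" "t \<in> S" "y \<in> carrier M"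
    "X = lfrac R S (regular_module R) s (a \<otimes> t)" "Y = lfrac R S M t y"
  using lfrac_composable[OF X] loc_module_cases[OF Y] by metis

lemma lfrac_smult_closed:
  assumes X: "X \<in> carrier (loc_ring R S)" and Y: "Y \<in> carrier (loc_module R S M)"
  shows "lfrac_smult R S M X Y \<in> carrier (loc_module R S M)"
  by (rule smult_cases[OF X Y]) (simp add: lfrac_smult_lfrac)

lemma lfrac_smult_one:
  assumes Y: "Y \<in> carrier (loc_module R S M)"
  shows "lfrac_smult R S M (lfrac R S (regular_module R) \<one> \<one>) Y = Y"
proof -
  obtain t y where ty: "t \<in> S" "y \<in> carrier M" "Y = lfrac R S M t y"
    using Y by (rule loc_module_cases)
  have "lfrac R S (regular_module R) \<one> \<one> = lfrac R S (regular_module R) t (\<one> \<otimes> t)"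
    using reg.lfrac_expand[of \<one> \<one> t] ty S_one by simp
  then show ?thesis
    using ty by (simp only: lfrac_smult_lfrac R.one_closed smult_one)
qed

end

context torsion_free_module
begin

text \<open>Matching the factors from right to left gives s^-1 (a t), t^-1 (b v) and v^-1 z. In
  either bracketing t and v cancel and s^-1 (a b z) remains.\<close>

lemma lfrac_smult_assoc:
  assumes X: "X \<in> carrier (loc_ring R S)" and Y: "Y \<in> carrier (loc_ring R S)"
    and Z: "Z \<in> carrier (loc_module R S M)"
  shows "lfrac_smult R S M (lfrac_smult R S (regular_module R) X Y) Z =
    lfrac_smult R S M X (lfrac_smult R S M Y Z)"
proof -
  obtain t b v z where 1: "t \<in> S" "b \<in> carrier R" "v \<in> S" "z \<in> carrier M"
    "Y = lfrac R S (regular_module R) t (b \<otimes> v)" "Z = lfrac R S M v z"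
    using smult_cases[OF Y Z] by metis
  obtain s a where 2: "s \<in> S" "a \<in> carrier R" "X = lfrac R S (regular_module R) s (a \<otimes> t)"
    using lfrac_composable[OF X 1(1)] by metis
  have "lfrac_smult R S (regular_module R) X Y = lfrac R S (regular_module R) s ((a \<otimes> b) \<otimes> v)"
    using 1 2 by (simp add: reg.lfrac_smult_lfrac m_assoc)
  then have "lfrac_smult R S M (lfrac_smult R S (regular_module R) X Y) Z =
      lfrac R S M s ((a \<otimes> b) \<odot>\<^bsub>M\<^esub> z)"
    using 1 2 by (simp add: lfrac_smult_lfrac)
  also have "\<dots> = lfrac_smult R S M X (lfrac_smult R S M Y Z)"
    using 1 2 by (simp add: lfrac_smult_lfrac smult_assoc1)
  finally show ?thesis .
qed

lemma lfrac_smult_r_distr: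
  assumes X: "X \<in> carrier (loc_ring R S)" and Y: "Y \<in> carrier (loc_module R S M)"
    and Z: "Z \<in> carrier (loc_module R S M)"
  shows "lfrac_smult R S M X (lfrac_add R S M Y Z) =
    lfrac_add R S M (lfrac_smult R S M X Y) (lfrac_smult R S M X Z)"
proof -
  obtain t y z where 1: "t \<in> S" "y \<in> carrier M" "z \<in> carrier M"
    "Y = lfrac R S M t y" "Z = lfrac R S M t z"
    using loc_module_cases2[OF Y Z] by metis
  obtain s a where 2: "s \<in> S" "a \<in> carrier R" "X = lfrac R S (regular_module R) s (a \<otimes> t)"
    using lfrac_composable[OF X 1(1)] by metis
  show ?thesis
    using 1 2 by (simp add: lfrac_smult_lfrac smult_r_distr)
qed

lemma lfrac_smult_l_distr:
  assumes X: "X \<in> carrier (loc_ring R S)" and Y: "Y \<in> carrier (loc_ring R S)"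
    and Z: "Z \<in> carrier (loc_module R S M)"
  shows "lfrac_smult R S M (lfrac_add R S (regular_module R) X Y) Z =
    lfrac_add R S M (lfrac_smult R S M X Z) (lfrac_smult R S M Y Z)"
proof -
  obtain s b t z where 1: "s \<in> S" "b \<in> carrier R" "t \<in> S" "z \<in> carrier M"
    "Y = lfrac R S (regular_module R) s (b \<otimes> t)" "Z = lfrac R S M t z"
    using smult_cases[OF Y Z] by metis
  obtain w a where 2: "w \<in> S" "a \<in> carrier R" "X = lfrac R S (regular_module R) w (a \<otimes> t)"
    using lfrac_composable[OF X 1(3)] by metis
  \<comment> \<open>Both numerators already end in the factor t that cancels against
    \<open>Z\<close>; expanding to a common denominator multiplies them on the left and keeps that
    factor. Here \<open>z\<close> merely fills the numerator slot of
    \<open>common_denominator\<close>.\<close>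
  obtain u c where 3: "u \<in> S" "u \<otimes> s \<in> S" "c \<in> carrier R" "u \<otimes> s = c \<otimes> w"
    using common_denominator[of s z w] 1 2 by metis
  have Y': "Y = lfrac R S (regular_module R) (u \<otimes> s) ((u \<otimes> b) \<otimes> t)"
    using 1 3(1,2) reg.lfrac_expand[of s "b \<otimes> t" u] by (simp add: m_assoc)
  have X': "X = lfrac R S (regular_module R) (u \<otimes> s) ((c \<otimes> a) \<otimes> t)"
    using 1 2 3 reg.lfrac_expand[of w "a \<otimes> t" c] by (simp add: m_assoc)
  have "lfrac_add R S (regular_module R) X Y =
      lfrac R S (regular_module R) (u \<otimes> s) ((c \<otimes> a \<oplus> u \<otimes> b) \<otimes> t)"
    unfolding X' Y' using 1 2 3(1-3) by (simp add: l_distr)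
  then have "lfrac_smult R S M (lfrac_add R S (regular_module R) X Y) Z =
      lfrac R S M (u \<otimes> s) ((c \<otimes> a \<oplus> u \<otimes> b) \<odot>\<^bsub>M\<^esub> z)"
    using 1 2 3(1-3) by (simp add: lfrac_smult_lfrac)
  also have "\<dots> = lfrac_add R S M (lfrac_smult R S M X Z) (lfrac_smult R S M Y Z)"
    unfolding X' Y' \<open>Z = lfrac R S M t z\<close>
    using 1(1-4) 2 3(1-3) by (simp add: lfrac_smult_lfrac smult_l_distr)
  finally show ?thesis .
qed

end

context regular_left_ore
begin

abbreviation frac where "frac \<equiv> lfrac R S (regular_module R)"

text \<open>All laws but the right unit are module laws for \<open>R\<close> acting on itself; the
  right unit is multiplication by a fraction with denominator 1.\<close>

lemma loc_ring_is_ring: "ring (loc_ring R S)"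
proof (rule ringI)
  show "abelian_group (loc_ring R S)"
    using reg.loc_module_abelian_group by (rule abelian_group_cong) simp_all
  show "monoid (loc_ring R S)"
  proof (rule monoidI)
    fix X assume X: "X \<in> carrier (loc_ring R S)"
    then have "X \<in> carrier (loc_module R S (regular_module R))"
      by simp
    then show "X \<otimes>\<^bsub>loc_ring R S\<^esub> \<one>\<^bsub>loc_ring R S\<^esub> = X"
      by (rule reg.loc_module_cases) (simp add: reg.lfrac_smult_integral)
  qed (use S_one in \<open>simp_all add: reg.lfrac_smult_closed reg.lfrac_smult_one
      reg.lfrac_smult_assoc\<close>)
qed (simp_all add: reg.lfrac_smult_l_distr reg.lfrac_smult_r_distr)

end

lemma (in torsion_free_module) loc_module_is_left_module:
  "left_module (loc_ring R S) (loc_module R S M)"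
proof -
  interpret L: ring "loc_ring R S"
    by (rule loc_ring_is_ring)
  interpret LM: abelian_group "loc_module R S M"
    by (rule loc_module_abelian_group)
  show ?thesis
    by unfold_locales
      (simp_all add: lfrac_smult_closed lfrac_smult_one lfrac_smult_assoc
        lfrac_smult_l_distr lfrac_smult_r_distr)
qed

section \<open>Ideals of the localization\<close>

context regular_left_ore
begin

definition contraction :: "('a \<times> 'a) set set \<Rightarrow> 'a set" where
  "contraction Q = {r \<in> carrier R. frac \<one> r \<in> Q}"

lemma frac_in_loc_ring: "s \<in> S \<Longrightarrow> r \<in> carrier R \<Longrightarrow> frac s r \<in> carrier (loc_ring R S)"
  by simp

lemma loc_ring_cases:
  assumes "X \<in> carrier (loc_ring R S)"
  obtains s r where "s \<in> S" "r \<in> carrier R" "X = frac s r"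
  using assms by (auto elim: reg.loc_module_cases)

lemma frac_mult:
  assumes "s \<in> S" "t \<in> S" "a \<in> carrier R" "r \<in> carrier R"
  shows "frac s (a \<otimes> t) \<otimes>\<^bsub>loc_ring R S\<^esub> frac t r = frac s (a \<otimes> r)"
  using reg.lfrac_smult_lfrac[of s t a r] assms by simp

lemma frac_mult_integral:
  assumes "s \<in> S" "a \<in> carrier R" "r \<in> carrier R"
  shows "frac s a \<otimes>\<^bsub>loc_ring R S\<^esub> frac \<one> r = frac s (a \<otimes> r)"
  using frac_mult[of s \<one> a r] assms S_one by simp

text \<open>Multiplying on the left by 1^-1 s or by s^-1 1 removes or restores the denominator, so
  an ideal sees numerators only.\<close>

lemma frac_mem_ideal_iff:
  assumes "ideal Q (loc_ring R S)" "s \<in> S" "r \<in> carrier R"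
  shows "frac s r \<in> Q \<longleftrightarrow> r \<in> contraction Q"
proof
  assume "frac s r \<in> Q"
  then have "frac \<one> (\<one> \<otimes> s) \<otimes>\<^bsub>loc_ring R S\<^esub> frac s r \<in> Q"
    using assms S_one by (intro ideal.I_l_closed[OF assms(1)] frac_in_loc_ring) auto
  then show "r \<in> contraction Q"
    using assms S_one frac_mult[of \<one> s \<one> r] by (simp add: contraction_def)
next
  assume "r \<in> contraction Q"
  then have "frac s \<one> \<otimes>\<^bsub>loc_ring R S\<^esub> frac \<one> r \<in> Q"
    using assms by (intro ideal.I_l_closed[OF assms(1)] frac_in_loc_ring) (auto simp: contraction_def)
  then show "frac s r \<in> Q"
    using assms frac_mult_integral[of s \<one> r] by simp
qed

lemma contraction_ideal:
  assumes "ideal Q (loc_ring R S)"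
  shows "ideal (contraction Q) R"
proof -
  interpret Q: ideal Q "loc_ring R S" by fact
  show ?thesis
  proof (rule idealI_elementwise)
    show "\<zero> \<in> contraction Q"
      using additive_subgroup.zero_closed[OF ideal.axioms(1)[OF assms]]
      unfolding loc_ring_sel contraction_def by blast
    fix x assume "x \<in> contraction Q"
    then have x: "x \<in> carrier R" "frac \<one> x \<in> Q"
      by (auto simp: contraction_def)
    show "x \<oplus> y \<in> contraction Q" if "y \<in> contraction Q" for y
      using additive_subgroup.a_closed[OF ideal.axioms(1)[OF assms] x(2), of "frac \<one> y"] that x S_one
      by (simp add: contraction_def)
    fix a assume a: "a \<in> carrier R"
    show "a \<otimes> x \<in> contraction Q"
      using Q.I_l_closed[OF x(2) frac_in_loc_ring[OF S_one a]] a x S_one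
      by (simp add: contraction_def frac_mult_integral del: loc_ring_sel)
    show "x \<otimes> a \<in> contraction Q"
      using Q.I_r_closed[OF x(2) frac_in_loc_ring[OF S_one a]] a x S_one
      by (simp add: contraction_def frac_mult_integral del: loc_ring_sel)
  qed (auto simp: contraction_def)
qed

lemma loc_ideal_contraction:
  assumes "ideal Q (loc_ring R S)"
  shows "loc_ideal R S (contraction Q) = Q"
proof
  show "loc_ideal R S (contraction Q) \<subseteq> Q"
    using frac_mem_ideal_iff[OF assms] by (auto simp: loc_ideal_def contraction_def)
  show "Q \<subseteq> loc_ideal R S (contraction Q)"
  proof
    fix X assume X: "X \<in> Q"
    then have "X \<in> carrier (loc_ring R S)"
      by (rule ideal.Icarr[OF assms])
    then obtain s r where "s \<in> S" "r \<in> carrier R" "X = frac s r"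
      by (rule loc_ring_cases)
    then show "X \<in> loc_ideal R S (contraction Q)"
      using X frac_mem_ideal_iff[OF assms] by (auto simp: loc_ideal_def)
  qed
qed

lemma frac_one_eq_zero_iff:
  "r \<in> carrier R \<Longrightarrow> frac \<one> r = \<zero>\<^bsub>loc_ring R S\<^esub> \<longleftrightarrow> r = \<zero>"
  using reg.lfrac_eq_zero_iff[of \<one> r] S_one by simp

lemma loc_ring_semiprime:
  assumes "semiprime_ring R"
  shows "semiprime_ring (loc_ring R S)"
proof -
  interpret L: ring "loc_ring R S"
    by (rule loc_ring_is_ring)
  show ?thesis
    unfolding L.semiprime_ring_iff
  proof (intro allI impI)
    fix Q assume Q: "ideal Q (loc_ring R S)"
      and sq: "\<forall>X\<in>Q. \<forall>Y\<in>Q. X \<otimes>\<^bsub>loc_ring R S\<^esub> Y = \<zero>\<^bsub>loc_ring R S\<^esub>"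
    have "x \<otimes> y = \<zero>" if "x \<in> contraction Q" "y \<in> contraction Q" for x y
    proof -
      have xy: "x \<in> carrier R" "y \<in> carrier R" "frac \<one> x \<in> Q" "frac \<one> y \<in> Q"
        using that by (auto simp: contraction_def)
      then have "frac \<one> (x \<otimes> y) = \<zero>\<^bsub>loc_ring R S\<^esub>"
        using sq frac_mult_integral[OF S_one xy(1,2)] by metis
      then show ?thesis
        using xy frac_one_eq_zero_iff by blast
    qed
    then have "contraction Q = {\<zero>}"
      using assms contraction_ideal[OF Q] semiprime_ring_iff by blast
    then have "Q = loc_ideal R S {\<zero>}"
      using loc_ideal_contraction[OF Q] by simp
    also have "\<dots> = (\<lambda>s. frac s \<zero>) ` S"
      unfolding loc_ideal_def by blast
    also have "\<dots> = (\<lambda>s. \<zero>\<^bsub>loc_ring R S\<^esub>) ` S"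
      using reg.lfrac_zero by (intro image_cong) simp_all
    also have "\<dots> = {\<zero>\<^bsub>loc_ring R S\<^esub>}"
      using S_one by blast
    finally show "Q = {\<zero>\<^bsub>loc_ring R S\<^esub>}" .
  qed
qed

end

text \<open>What is needed of a minimal prime, with primeness itself left out. Left saturation makes
  membership of fractions independent of their representation; right saturation makes the extended
  ideal two-sided. Modulo \<open>I\<close> they say that the image of \<open>S\<close> is regular on
  the left and on the right.\<close>

locale saturated_ideal = regular_left_ore R S + ideal I R for R (structure) and S and I +
  assumes saturated_left: "\<lbrakk>s \<in> S; a \<in> carrier R; s \<otimes> a \<in> I\<rbrakk> \<Longrightarrow> a \<in> I"
    and saturated_right: "\<lbrakk>s \<in> S; a \<in> carrier R; a \<otimes> s \<in> I\<rbrakk> \<Longrightarrow> a \<in> I"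
    and proper: "I \<noteq> carrier R"
begin

text \<open>\<open>loc_ideal\<close> only promises that some representation has its numerator in
  \<open>I\<close>. Over a common denominator u r = a p lies in \<open>I\<close>, and left
  saturation removes u.\<close>

lemma frac_mem_loc_ideal_iff:
  assumes "s \<in> S" "r \<in> carrier R"
  shows "frac s r \<in> loc_ideal R S I \<longleftrightarrow> r \<in> I"
proof
  assume "frac s r \<in> loc_ideal R S I"
  then obtain t p where tp: "t \<in> S" "p \<in> I" "frac s r = frac t p"
    by (auto simp: loc_ideal_def)
  obtain u a where ua: "u \<in> S" "a \<in> carrier R" "u \<otimes> s = a \<otimes> t"
    using ore[of s t] assms tp by auto
  have "u \<otimes> r = a \<otimes> p"
    using tp ua assms reg.lfrac_eq_iff[of s t r p] by auto
  then have "u \<otimes> r \<in> I"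
    using I_l_closed[OF tp(2) ua(2)] by simp
  then show "r \<in> I"
    using saturated_left ua(1) assms(2) by blast
qed (use assms in \<open>auto simp: loc_ideal_def\<close>)

lemma loc_ideal_is_ideal: "ideal (loc_ideal R S I) (loc_ring R S)"
proof -
  interpret L: ring "loc_ring R S"
    by (rule loc_ring_is_ring)
  have sub: "loc_ideal R S I \<subseteq> carrier (loc_ring R S)"
    by (auto simp: loc_ideal_def)
  show ?thesis
  proof (rule L.idealI_elementwise)
    show "\<zero>\<^bsub>loc_ring R S\<^esub> \<in> loc_ideal R S I"
      using S_one frac_mem_loc_ideal_iff[of \<one> \<zero>] by simp
    fix X assume X: "X \<in> loc_ideal R S I"
    show "X \<oplus>\<^bsub>loc_ring R S\<^esub> Y \<in> loc_ideal R S I" if Y: "Y \<in> loc_ideal R S I" for Y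
    proof -
      have "X \<in> carrier (loc_module R S (regular_module R))"
        "Y \<in> carrier (loc_module R S (regular_module R))"
        using X Y sub by auto
      then obtain s x y where "s \<in> S" "x \<in> carrier R" "y \<in> carrier R" "X = frac s x" "Y = frac s y"
        by (rule reg.loc_module_cases2) simp
      then show ?thesis
        using X Y by (simp add: frac_mem_loc_ideal_iff)
    qed
    fix A assume A: "A \<in> carrier (loc_ring R S)"
    have X': "X \<in> carrier (loc_module R S (regular_module R))"
      using X sub by auto
    obtain s a t x where "s \<in> S" "a \<in> carrier R" "t \<in> S" "x \<in> carrier R"
      "A = frac s (a \<otimes> t)" "X = frac t x"
      by (rule reg.smult_cases[OF A X']) simp
    then show "A \<otimes>\<^bsub>loc_ring R S\<^esub> X \<in> loc_ideal R S I"
      using X by (simp add: frac_mult frac_mem_loc_ideal_iff I_l_closed del: loc_ring_sel)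
    \<comment> \<open>The side that fails for a general ideal: to multiply by \<open>A\<close> on
      the right, \<open>X\<close> is rewritten with numerator x t, and only this product is known to
      lie in \<open>I\<close>. Right saturation recovers x.\<close>
    have A': "A \<in> carrier (loc_module R S (regular_module R))"
      using A by simp
    obtain s x t a where *: "s \<in> S" "x \<in> carrier R" "t \<in> S" "a \<in> carrier R"
      "X = frac s (x \<otimes> t)" "A = frac t a"
      using X' by (rule reg.smult_cases[OF _ A', of X, simplified])
    then have "x \<otimes> t \<in> I"
      using X by (simp add: frac_mem_loc_ideal_iff)
    then have "x \<in> I"
      using saturated_right * by blast
    then show "X \<otimes>\<^bsub>loc_ring R S\<^esub> A \<in> loc_ideal R S I"
      using * by (simp add: frac_mult frac_mem_loc_ideal_iff I_r_closed del: loc_ring_sel)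
  qed (fact sub)
qed

lemma contraction_loc_ideal: "contraction (loc_ideal R S I) = I"
  using S_one by (auto simp: contraction_def frac_mem_loc_ideal_iff)

text \<open>Products are tested on the contractions of \<open>A\<close> and \<open>B\<close>, where
  primeness of \<open>I\<close> applies; extending the smaller side again returns the ideal of the
  localization.\<close>

lemma loc_ideal_prime:
  assumes "prime_ideal R I"
  shows "prime_ideal (loc_ring R S) (loc_ideal R S I)"
proof -
  interpret L: ring "loc_ring R S"
    by (rule loc_ring_is_ring)
  show ?thesis
    unfolding L.prime_ideal_iff
  proof (intro conjI allI impI)
    show "loc_ideal R S I \<noteq> carrier (loc_ring R S)"
    proof
      assume "loc_ideal R S I = carrier (loc_ring R S)"
      then have "r \<in> I" if "r \<in> carrier R" for r
        using frac_in_loc_ring[OF S_one that] frac_mem_loc_ideal_iff[OF S_one that] by blast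
      then show False
        using proper a_subset by blast
    qed
    fix A B assume AB: "ideal A (loc_ring R S)" "ideal B (loc_ring R S)"
      and prod: "\<forall>X\<in>A. \<forall>Y\<in>B. X \<otimes>\<^bsub>loc_ring R S\<^esub> Y \<in> loc_ideal R S I"
    have "x \<otimes> y \<in> I" if "x \<in> contraction A" "y \<in> contraction B" for x y
    proof -
      have xy: "x \<in> carrier R" "y \<in> carrier R" "frac \<one> x \<in> A" "frac \<one> y \<in> B"
        using that by (auto simp: contraction_def)
      then have "frac \<one> (x \<otimes> y) \<in> loc_ideal R S I"
        using prod frac_mult_integral[OF S_one xy(1,2)] by metis
      then show ?thesis
        using frac_mem_loc_ideal_iff S_one xy by simp
    qed
    then have "contraction A \<subseteq> I \<or> contraction B \<subseteq> I"
      using prime_idealD[OF assms contraction_ideal[OF AB(1)] contraction_ideal[OF AB(2)]] by blast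
    then have "loc_ideal R S (contraction A) \<subseteq> loc_ideal R S I \<or>
        loc_ideal R S (contraction B) \<subseteq> loc_ideal R S I"
      unfolding loc_ideal_def by blast
    then show "A \<subseteq> loc_ideal R S I \<or> B \<subseteq> loc_ideal R S I"
      using loc_ideal_contraction AB by simp
  qed (rule loc_ideal_is_ideal)
qed

end

section \<open>Saturation of minimal primes, and the minimal primes of the localization\<close>

lemma (in ring) left_annihilator_ideal:
  assumes "ideal J R"
  shows "ideal {x \<in> carrier R. \<forall>q\<in>J. x \<otimes> q = \<zero>} R"
proof -
  interpret J: ideal J R by fact
  show ?thesis
    by (rule idealI_elementwise) (auto simp: l_distr m_assoc J.I_l_closed)
qed

lemma (in ring) right_annihilator_ideal:
  assumes "ideal J R"
  shows "ideal {x \<in> carrier R. \<forall>q\<in>J. q \<otimes> x = \<zero>} R"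
proof -
  interpret J: ideal J R by fact
  show ?thesis
    by (rule idealI_elementwise) (auto simp: r_distr m_assoc[symmetric] J.I_r_closed)
qed

text \<open>With finitely many minimal primes, \<open>P\<close> is both the left and the right annihilator of
  the intersection \<open>Q\<close> of the other ones, and annihilators absorb regular factors.\<close>

lemma (in regular_left_ore) min_prime_saturated:
  assumes R: "semiprime_ring R" and fin: "finite (min_primes R)" and P: "P \<in> min_primes R"
  shows "saturated_ideal R S P"
proof -
  define Q where "Q = carrier R \<inter> \<Inter>(min_primes R - {P})"
  have prime: "prime_ideal R P'" if "P' \<in> min_primes R" for P'
    using that by (simp add: min_primes_def)
  have ideal: "ideal P' R" if "P' \<in> min_primes R" for P'
    using prime[OF that] by (rule prime_ideal_ideal)
  interpret P: ideal P R
    using P by (rule ideal)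
  have Q: "ideal Q R"
    unfolding Q_def using ideal by (intro ideal_Inter_carrier) simp
  \<comment> \<open>Finiteness enters here: a prime above a finite intersection lies above a member,
    and distinct minimal primes are incomparable.\<close>
  have nQ: "\<not> Q \<subseteq> P"
  proof
    assume "Q \<subseteq> P"
    then have "\<exists>I\<in>min_primes R - {P}. I \<subseteq> P"
      using fin ideal unfolding Q_def by (intro prime_ideal_finite_Inter[OF prime[OF P]]) auto
    then show False
      using P by (auto simp: min_primes_def)
  qed
  have zero: "x = \<zero>" if "x \<in> P" "x \<in> Q" for x
    using that by (intro semiprime_Inter_min_primes[OF R]) (auto simp: Q_def)
  \<comment> \<open>Both products lie in \<open>P\<close> and in \<open>Q\<close>, hence in every
    minimal prime, so semiprimeness makes them zero.\<close>
  have zl: "x \<otimes> q = \<zero>" and zr: "q \<otimes> x = \<zero>" if "x \<in> P" "q \<in> Q" for x q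
    using that ideal.I_l_closed[OF Q that(2)] ideal.I_r_closed[OF Q that(2)] ideal.Icarr[OF Q that(2)]
      P.I_l_closed[OF that(1)] P.I_r_closed[OF that(1)] by (simp_all add: zero)
  have zero_in: "\<zero> \<in> P"
    by simp
  \<comment> \<open>The annihilator of \<open>Q\<close> times \<open>Q\<close> is zero, hence inside
    \<open>P\<close>. As \<open>Q\<close> is not, primeness puts the annihilator into
    \<open>P\<close>.\<close>
  have memI: "x \<in> P" if "x \<in> carrier R" "\<And>q. q \<in> Q \<Longrightarrow> x \<otimes> q = \<zero>" for x
    using prime_idealD[OF prime[OF P] left_annihilator_ideal[OF Q] Q] nQ that zero_in by auto
  have memI': "x \<in> P" if "x \<in> carrier R" "\<And>q. q \<in> Q \<Longrightarrow> q \<otimes> x = \<zero>" for x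
    using prime_idealD[OF prime[OF P] Q right_annihilator_ideal[OF Q]] nQ that zero_in by auto
  show ?thesis
  proof unfold_locales
    fix s a assume sa: "s \<in> S" "a \<in> carrier R"
    show "a \<in> P" if "s \<otimes> a \<in> P"
    proof (rule memI[OF sa(2)])
      fix q assume q: "q \<in> Q"
      then have "s \<otimes> (a \<otimes> q) = \<zero>"
        using zl[OF that q] sa ideal.Icarr[OF Q q] by (simp add: m_assoc)
      then show "a \<otimes> q = \<zero>"
        using left_regular sa ideal.Icarr[OF Q q] by simp
    qed
    show "a \<in> P" if "a \<otimes> s \<in> P"
    proof (rule memI'[OF sa(2)])
      fix q assume q: "q \<in> Q"
      then have "(q \<otimes> a) \<otimes> s = \<zero>"
        using zr[OF that q] sa ideal.Icarr[OF Q q] by (simp add: m_assoc)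
      then show "q \<otimes> a = \<zero>"
        using right_regular sa ideal.Icarr[OF Q q] by simp
    qed
  next
    show "P \<noteq> carrier R"
      using prime_ideal_proper[OF prime[OF P]] by blast
  qed
qed

context regular_left_ore
begin

lemma loc_ideal_le_iff:
  assumes "saturated_ideal R S I" "saturated_ideal R S J"
  shows "loc_ideal R S I \<subseteq> loc_ideal R S J \<longleftrightarrow> I \<subseteq> J"
proof
  assume "loc_ideal R S I \<subseteq> loc_ideal R S J"
  then have "contraction (loc_ideal R S I) \<subseteq> contraction (loc_ideal R S J)"
    by (auto simp: contraction_def)
  then show "I \<subseteq> J"
    using assms by (simp add: saturated_ideal.contraction_loc_ideal)
qed (auto simp: loc_ideal_def)

lemma min_primes_loc_ring:
  assumes R: "semiprime_ring R" and fin: "finite (min_primes R)"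
  shows "min_primes (loc_ring R S) = loc_ideal R S ` min_primes R"
    and "inj_on (loc_ideal R S) (min_primes R)"
proof -
  interpret L: ring "loc_ring R S"
    by (rule loc_ring_is_ring)
  have sat: "saturated_ideal R S P" if "P \<in> min_primes R" for P
    using min_prime_saturated[OF R fin that] .
  have prime: "prime_ideal (loc_ring R S) (loc_ideal R S P)" if "P \<in> min_primes R" for P
    using saturated_ideal.loc_ideal_prime[OF sat[OF that]] that by (simp add: min_primes_def)
  \<comment> \<open>A fraction in all the extended ideals has its numerator in every minimal prime
    of \<open>R\<close>, so it is zero. Thus \<open>Q\<close> contains a finite intersection of
    ideals, and hence one of them.\<close>
  have below: "\<exists>P\<in>min_primes R. loc_ideal R S P \<subseteq> Q" if Q: "prime_ideal (loc_ring R S) Q" for Q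
  proof -
    have "carrier (loc_ring R S) \<inter> \<Inter>(loc_ideal R S ` min_primes R) \<subseteq> Q"
    proof
      fix X assume X: "X \<in> carrier (loc_ring R S) \<inter> \<Inter>(loc_ideal R S ` min_primes R)"
      then have "X \<in> carrier (loc_ring R S)"
        by blast
      then obtain s r where sr: "s \<in> S" "r \<in> carrier R" "X = frac s r"
        by (rule loc_ring_cases)
      have "r \<in> P" if "P \<in> min_primes R" for P
        using X that saturated_ideal.frac_mem_loc_ideal_iff[OF sat[OF that] sr(1,2)] sr(3) by blast
      then have "r = \<zero>"
        using semiprime_Inter_min_primes[OF R sr(2)] by blast
      then have "X = \<zero>\<^bsub>loc_ring R S\<^esub>"
        using sr reg.lfrac_zero by simp
      then show "X \<in> Q"
        using additive_subgroup.zero_closed[OF ideal.axioms(1)[OF L.prime_ideal_ideal[OF Q]]] by simp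
    qed
    then have "\<exists>I\<in>loc_ideal R S ` min_primes R. I \<subseteq> Q"
      using fin saturated_ideal.loc_ideal_is_ideal[OF sat]
      by (intro L.prime_ideal_finite_Inter[OF Q]) auto
    then show ?thesis
      by blast
  qed
  show "min_primes (loc_ring R S) = loc_ideal R S ` min_primes R"
  proof (intro equalityI subsetI)
    fix Q assume Q: "Q \<in> min_primes (loc_ring R S)"
    then obtain P where "P \<in> min_primes R" "loc_ideal R S P \<subseteq> Q"
      using below[of Q] unfolding min_primes_def by blast
    moreover from this have "loc_ideal R S P = Q"
      using Q prime[of P] unfolding min_primes_def by blast
    ultimately show "Q \<in> loc_ideal R S ` min_primes R"
      by blast
  next
    fix Q assume "Q \<in> loc_ideal R S ` min_primes R"
    then obtain P where P: "P \<in> min_primes R" "Q = loc_ideal R S P"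
      by blast
    have "Q' = Q" if Q': "prime_ideal (loc_ring R S) Q'" "Q' \<subseteq> Q" for Q'
    proof -
      \<comment> \<open>\<open>Q'\<close> is squeezed between the extensions of \<open>P'\<close>
        and \<open>P\<close>; the inclusion descends to \<open>R\<close>, where minimality of
        \<open>P\<close> makes the two coincide.\<close>
      obtain P' where P': "P' \<in> min_primes R" "loc_ideal R S P' \<subseteq> Q'"
        using below[OF Q'(1)] by blast
      then have "P' \<subseteq> P"
        using loc_ideal_le_iff[OF sat[OF P'(1)] sat[OF P(1)]] Q'(2) P(2) by blast
      then have "P' = P"
        using P P' by (auto simp: min_primes_def)
      then show ?thesis
        using P P' Q' by blast
    qed
    then show "Q \<in> min_primes (loc_ring R S)"
      using prime P by (auto simp: min_primes_def)
  qed
  show "inj_on (loc_ideal R S) (min_primes R)"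
    using saturated_ideal.contraction_loc_ideal[OF sat] by (intro inj_on_inverseI)
qed

end

section \<open>Maps between localizations\<close>

text \<open>Functoriality of localization, with \<open>h\<close> acting on denominators and
  \<open>f\<close> on numerators. As for the operations on classes, a union over representatives
  avoids choosing one.\<close>

definition loc_map ::
  "('a, 'c) ring_scheme \<Rightarrow> 'a set \<Rightarrow> ('a, 'm, 'd) module_scheme \<Rightarrow> ('e \<Rightarrow> 'a) \<Rightarrow> ('n \<Rightarrow> 'm) \<Rightarrow>
    ('e \<times> 'n) set \<Rightarrow> ('a \<times> 'm) set"
  where "loc_map R' S' M' h f X = (\<Union>(s, x)\<in>X. lfrac R' S' M' (h s) (f x))"

text \<open>Semilinearity of \<open>f\<close> along \<open>h\<close> serves both isomorphisms: for
  rings \<open>h\<close> and \<open>f\<close> are the projection onto the quotient, for modules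
  \<open>h\<close> is the identity and only \<open>f\<close> projects.\<close>

locale loc_hom = D: torsion_free_module R M S + C: torsion_free_module R' M' S'
  for R (structure) and M (structure) and S and R' (structure) and M' (structure) and S' +
  fixes h f
  assumes h_hom: "h \<in> ring_hom R R'"
    and h_S: "s \<in> S \<Longrightarrow> h s \<in> S'"
    and f_closed: "x \<in> carrier M \<Longrightarrow> f x \<in> carrier M'"
    and f_add: "\<lbrakk>x \<in> carrier M; y \<in> carrier M\<rbrakk> \<Longrightarrow> f (x \<oplus>\<^bsub>M\<^esub> y) = f x \<oplus>\<^bsub>M'\<^esub> f y"
    and f_smult: "\<lbrakk>a \<in> carrier R; x \<in> carrier M\<rbrakk> \<Longrightarrow> f (a \<odot>\<^bsub>M\<^esub> x) = h a \<odot>\<^bsub>M'\<^esub> f x"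
begin

text \<open>An Ore witness for equality of two fractions is mapped by \<open>h\<close> to one in the
  target, so all representatives contribute the same class.\<close>

lemma loc_map_lfrac:
  assumes "s \<in> S" "x \<in> carrier M"
  shows "loc_map R' S' M' h f (lfrac R S M s x) = lfrac R' S' M' (h s) (f x)"
proof -
  have "lfrac R' S' M' (h t) (f y) = lfrac R' S' M' (h s) (f x)"
    if ty: "(t, y) \<in> lfrac R S M s x" for t y
  proof -
    have ty': "t \<in> S" "y \<in> carrier M" "lfrac R S M t y = lfrac R S M s x"
      using ty assms by (auto simp: D.mem_lfrac_iff)
    obtain u a where ua: "u \<in> S" "a \<in> carrier R" "u \<otimes> t = a \<otimes> s"
      using D.ore[of t s] ty' assms by auto
    have "u \<odot>\<^bsub>M\<^esub> y = a \<odot>\<^bsub>M\<^esub> x"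
      using ty' ua assms D.lfrac_eq_iff[of t s y x] by simp
    then have "h u \<odot>\<^bsub>M'\<^esub> f y = h a \<odot>\<^bsub>M'\<^esub> f x"
      using ty' ua assms f_smult[of u y] f_smult[of a x] by simp
    moreover have "h u \<otimes>\<^bsub>R'\<^esub> h t = h a \<otimes>\<^bsub>R'\<^esub> h s"
      using ty' ua assms ring_hom_mult[OF h_hom, of u t] ring_hom_mult[OF h_hom, of a s] by simp
    ultimately show ?thesis
      using ty' ua assms h_S f_closed C.S_mult[of "h u" "h t"] ring_hom_closed[OF h_hom]
      by (intro C.lfrac_eqI[where a = "h u" and b = "h a"]) auto
  qed
  moreover have "(s, x) \<in> lfrac R S M s x"
    using assms by (simp add: D.mem_lfrac_iff)
  ultimately show ?thesis
    unfolding loc_map_def by (intro equalityI subsetI) blast+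
qed

lemma loc_map_closed:
  assumes "X \<in> carrier (loc_module R S M)"
  shows "loc_map R' S' M' h f X \<in> carrier (loc_module R' S' M')"
  using assms by (rule D.loc_module_cases) (simp add: loc_map_lfrac h_S f_closed)

lemma loc_map_add:
  assumes "X \<in> carrier (loc_module R S M)" "Y \<in> carrier (loc_module R S M)"
  shows "loc_map R' S' M' h f (lfrac_add R S M X Y) =
    lfrac_add R' S' M' (loc_map R' S' M' h f X) (loc_map R' S' M' h f Y)"
  using assms by (rule D.loc_module_cases2) (simp add: loc_map_lfrac h_S f_closed f_add)

lemma loc_map_surj:
  assumes "h ` S = S'" "f ` carrier M = carrier M'"
  shows "loc_map R' S' M' h f ` carrier (loc_module R S M) = carrier (loc_module R' S' M')"
proof (intro equalityI subsetI)
  fix Y assume "Y \<in> carrier (loc_module R' S' M')"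
  then obtain t y where "t \<in> S'" "y \<in> carrier M'" "Y = lfrac R' S' M' t y"
    by (rule C.loc_module_cases)
  moreover from this obtain s x where "s \<in> S" "t = h s" "x \<in> carrier M" "y = f x"
    using assms by blast
  ultimately have "lfrac R S M s x \<in> carrier (loc_module R S M)"
    "Y = loc_map R' S' M' h f (lfrac R S M s x)"
    by (simp_all add: loc_map_lfrac)
  then show "Y \<in> loc_map R' S' M' h f ` carrier (loc_module R S M)"
    by blast
qed (use loc_map_closed in blast)

lemma regular_loc_hom: "loc_hom R (regular_module R) S R' (regular_module R') S' h h"
  using h_hom h_S ring_hom_closed[OF h_hom] ring_hom_add[OF h_hom] ring_hom_mult[OF h_hom]
  by (intro loc_hom.intro loc_hom_axioms.intro
      D.regular_torsion_free_module C.regular_torsion_free_module) simp_all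

lemma loc_map_smult:
  assumes X: "X \<in> carrier (loc_ring R S)" and Y: "Y \<in> carrier (loc_module R S M)"
  shows "loc_map R' S' M' h f (lfrac_smult R S M X Y) =
    lfrac_smult R' S' M' (loc_map R' S' (regular_module R') h h X) (loc_map R' S' M' h f Y)"
proof -
  interpret reg: loc_hom R "regular_module R" S R' "regular_module R'" S' h h
    by (rule regular_loc_hom)
  obtain s a t y where *: "s \<in> S" "a \<in> carrier R" "t \<in> S" "y \<in> carrier M"
    "X = lfrac R S (regular_module R) s (a \<otimes> t)" "Y = lfrac R S M t y"
    by (rule D.smult_cases[OF X Y])
  then have "loc_map R' S' (regular_module R') h h X =
      lfrac R' S' (regular_module R') (h s) (h a \<otimes>\<^bsub>R'\<^esub> h t)"
    using ring_hom_mult[OF h_hom] by (simp add: reg.loc_map_lfrac)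
  then show ?thesis
    using * ring_hom_closed[OF h_hom]
    by (simp add: loc_map_lfrac D.lfrac_smult_lfrac C.lfrac_smult_lfrac f_smult h_S f_closed)
qed

end

section \<open>Quotient modules\<close>

context ideal
begin

lemma coset_eq_iff:
  assumes "x \<in> carrier R" "y \<in> carrier R"
  shows "I +> x = I +> y \<longleftrightarrow> x \<ominus> y \<in> I"
  using a_rcos_module[OF assms(2,1)] a_repr_independence'[OF _ assms(2), of x] a_rcos_self[OF assms(1)]
  by (auto simp: minus_eq)

lemma coset_eq_ideal_iff: "x \<in> carrier R \<Longrightarrow> I +> x = I \<longleftrightarrow> x \<in> I"
  using coset_eq_iff[of x \<zero>] a_coset_add_zero[OF a_subset] by (simp add: minus_eq)

lemma carrier_Quot: "carrier (R Quot I) = (+>) I ` carrier R"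
  by (auto simp: FactRing_def A_RCOSETS_def')

lemma quotient_module_sel [simp]:
  "carrier (quotient_module R I) = (\<lambda>x. I +> x) ` carrier R"
  "add (quotient_module R I) = set_add R"
  "zero (quotient_module R I) = I"
  by (simp_all add: quotient_module_def carrier_Quot) (simp_all add: FactRing_def)

lemma quotient_module_smult [simp]:
  assumes r: "r \<in> carrier R" and x: "x \<in> carrier R"
  shows "r \<odot>\<^bsub>quotient_module R I\<^esub> (I +> x) = I +> (r \<otimes> x)"
proof -
  have "I +> (r \<otimes> y) = I +> (r \<otimes> x)" if y: "y \<in> I +> x" for y
  proof -
    have yc: "y \<in> carrier R"
      using a_elemrcos_carrier[OF x y] .
    have "y \<ominus> x \<in> I"
      using a_rcos_module[OF x yc] y by (simp add: minus_eq)
    then have "r \<otimes> (y \<ominus> x) \<in> I"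
      using r by (rule I_l_closed)
    then show ?thesis
      using r x yc coset_eq_iff by (simp add: minus_eq r_distr r_minus)
  qed
  moreover have "x \<in> I +> x"
    using x by (rule a_rcos_self)
  ultimately have "(\<Union>y\<in>I +> x. I +> (r \<otimes> y)) = I +> (r \<otimes> x)"
    by blast
  then show ?thesis
    by (simp add: quotient_module_def)
qed

lemma quotient_module_is_left_module: "left_module R (quotient_module R I)"
proof -
  interpret Q: abelian_group "quotient_module R I"
    using ring.axioms(1)[OF quotient_is_ring]
    by (rule abelian_group_cong) (simp_all add: quotient_module_def)
  show ?thesis
    by unfold_locales (auto simp: a_rcos_sum l_distr r_distr m_assoc)
qed

text \<open>The first isomorphism theorem for a surjective left module map defined on the ring
  itself.\<close>

lemma quotient_module_isomorphic:
  assumes N: "left_module R N" and surj: "g ` carrier R = carrier N"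
    and add: "\<And>x y. \<lbrakk>x \<in> carrier R; y \<in> carrier R\<rbrakk> \<Longrightarrow> g (x \<oplus> y) = g x \<oplus>\<^bsub>N\<^esub> g y"
    and smult: "\<And>a x. \<lbrakk>a \<in> carrier R; x \<in> carrier R\<rbrakk> \<Longrightarrow> g (a \<otimes> x) = a \<odot>\<^bsub>N\<^esub> g x"
    and ker: "\<And>x. x \<in> carrier R \<Longrightarrow> g x = \<zero>\<^bsub>N\<^esub> \<longleftrightarrow> x \<in> I"
  shows "left_module_isomorphic R (quotient_module R I) N"
proof -
  interpret N: left_module R N
    by fact
  have gc: "g x \<in> carrier N" if "x \<in> carrier R" for x
    using surj that by blast
  have g_eq: "g x = g y \<longleftrightarrow> I +> x = I +> y" if xy: "x \<in> carrier R" "y \<in> carrier R" for x y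
  proof -
    have "g x = g ((x \<ominus> y) \<oplus> y)"
      using xy by (simp add: minus_eq a_assoc l_neg)
    also have "\<dots> = g (x \<ominus> y) \<oplus>\<^bsub>N\<^esub> g y"
      using xy by (intro add) auto
    finally have *: "g x = g (x \<ominus> y) \<oplus>\<^bsub>N\<^esub> g y" .
    have "g x = g y \<longleftrightarrow> g (x \<ominus> y) \<oplus>\<^bsub>N\<^esub> g y = \<zero>\<^bsub>N\<^esub> \<oplus>\<^bsub>N\<^esub> g y"
      using * gc xy by simp
    also have "\<dots> \<longleftrightarrow> g (x \<ominus> y) = \<zero>\<^bsub>N\<^esub>"
      using gc xy by (intro N.M.add.right_cancel) auto
    finally show ?thesis
      using ker[of "x \<ominus> y"] coset_eq_iff xy by simp
  qed
  \<comment> \<open>\<open>g_eq\<close> serves twice: from right to left the value does not depend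
    on the representative, from left to right \<open>F\<close> is injective.\<close>
  define F where "F X = (THE z. \<exists>x\<in>carrier R. X = I +> x \<and> z = g x)" for X
  have F: "F (I +> x) = g x" if x: "x \<in> carrier R" for x
    unfolding F_def using x g_eq by (intro the_equality) blast+
  have "bij_betw F (carrier (quotient_module R I)) (carrier N)"
  proof (rule bij_betw_imageI)
    show "inj_on F (carrier (quotient_module R I))"
      by (rule inj_onI) (auto simp: F g_eq)
    show "F ` carrier (quotient_module R I) = carrier N"
      using surj F by (simp add: image_image)
  qed
  moreover have "F (X \<oplus>\<^bsub>quotient_module R I\<^esub> Y) = F X \<oplus>\<^bsub>N\<^esub> F Y"
    if "X \<in> carrier (quotient_module R I)" "Y \<in> carrier (quotient_module R I)" for X Y
    using that by (auto simp: F add a_rcos_sum)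
  moreover have "F (a \<odot>\<^bsub>quotient_module R I\<^esub> X) = a \<odot>\<^bsub>N\<^esub> F X"
    if "a \<in> carrier R" "X \<in> carrier (quotient_module R I)" for a X
    using that by (auto simp: F smult)
  ultimately show ?thesis
    using N quotient_module_is_left_module unfolding left_module_isomorphic_def by blast
qed

end

section \<open>The localized quotient as a ring and as a module\<close>

context saturated_ideal
begin

text \<open>The Ore condition passes to any quotient; the two regularity conditions are the two
  saturation conditions read modulo \<open>I\<close>.\<close>

lemma quotient_regular_left_ore: "regular_left_ore (R Quot I) ((+>) I ` S)"
proof -
  have zero: "\<zero>\<^bsub>R Quot I\<^esub> = I" and one: "\<one>\<^bsub>R Quot I\<^esub> = I +> \<one>"
    by (simp_all add: FactRing_def)
  have mult: "(I +> x) \<otimes>\<^bsub>R Quot I\<^esub> (I +> y) = I +> (x \<otimes> y)"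
    if "x \<in> carrier R" "y \<in> carrier R" for x y
    using ring_hom_mult[OF rcos_ring_hom] that by simp
  show ?thesis
  proof (intro regular_left_ore.intro quotient_is_ring regular_left_ore_axioms.intro)
    show "(+>) I ` S \<subseteq> carrier (R Quot I)"
      using S_carrier carrier_Quot by blast
    show "X \<otimes>\<^bsub>R Quot I\<^esub> Y \<in> (+>) I ` S" if "X \<in> (+>) I ` S" "Y \<in> (+>) I ` S" for X Y
      using that S_mult by (auto simp: mult)
    show "\<one>\<^bsub>R Quot I\<^esub> \<in> (+>) I ` S"
      using S_one one by blast
    show "\<zero>\<^bsub>R Quot I\<^esub> \<notin> (+>) I ` S"
    proof
      assume "\<zero>\<^bsub>R Quot I\<^esub> \<in> (+>) I ` S"
      then obtain s where s: "s \<in> S" "I +> s = I"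
        using zero by blast
      \<comment> \<open>The factor 1 is written out so that left saturation puts 1 itself into
        \<open>I\<close>, contradicting properness.\<close>
      then have "s \<otimes> \<one> \<in> I"
        using coset_eq_ideal_iff by simp
      then have "\<one> \<in> I"
        using s saturated_left by blast
      then show False
        using one_imp_carrier proper by blast
    qed
    show "\<exists>U\<in>(+>) I ` S. \<exists>A\<in>carrier (R Quot I). U \<otimes>\<^bsub>R Quot I\<^esub> X = A \<otimes>\<^bsub>R Quot I\<^esub> Y"
      if XY: "X \<in> carrier (R Quot I)" "Y \<in> (+>) I ` S" for X Y
    proof -
      obtain r s where rs: "r \<in> carrier R" "X = I +> r" "s \<in> S" "Y = I +> s"
        using XY carrier_Quot by blast
      then obtain u a where ua: "u \<in> S" "a \<in> carrier R" "u \<otimes> r = a \<otimes> s"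
        using ore by blast
      then have "(I +> u) \<otimes>\<^bsub>R Quot I\<^esub> X = (I +> a) \<otimes>\<^bsub>R Quot I\<^esub> Y"
        using rs by (simp add: mult)
      then show ?thesis
        using ua carrier_Quot by blast
    qed
    show "X = \<zero>\<^bsub>R Quot I\<^esub>"
      if XY: "Y \<in> (+>) I ` S" "X \<in> carrier (R Quot I)" "Y \<otimes>\<^bsub>R Quot I\<^esub> X = \<zero>\<^bsub>R Quot I\<^esub>" for X Y
    proof -
      obtain r s where rs: "r \<in> carrier R" "X = I +> r" "s \<in> S" "Y = I +> s"
        using XY carrier_Quot by blast
      then have "I +> (s \<otimes> r) = I"
        using XY(3) zero mult[of s r] by simp
      then have "s \<otimes> r \<in> I"
        using rs coset_eq_ideal_iff by simp
      with rs have "r \<in> I"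
        using saturated_left by blast
      then show ?thesis
        using rs coset_eq_ideal_iff zero by simp
    qed
    show "X = \<zero>\<^bsub>R Quot I\<^esub>"
      if XY: "Y \<in> (+>) I ` S" "X \<in> carrier (R Quot I)" "X \<otimes>\<^bsub>R Quot I\<^esub> Y = \<zero>\<^bsub>R Quot I\<^esub>" for X Y
    proof -
      obtain r s where rs: "r \<in> carrier R" "X = I +> r" "s \<in> S" "Y = I +> s"
        using XY carrier_Quot by blast
      then have "I +> (r \<otimes> s) = I"
        using XY(3) zero mult[of r s] by simp
      then have "r \<otimes> s \<in> I"
        using rs coset_eq_ideal_iff by simp
      with rs have "r \<in> I"
        using saturated_right by blast
      then show ?thesis
        using rs coset_eq_ideal_iff zero by simp
    qed
  qed
qed

text \<open>Left saturation in module language; it opens the calculus of fractions to R/I as an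
  \<open>R\<close>-module.\<close>

lemma quotient_torsion_free_module: "torsion_free_module R (quotient_module R I) S"
proof (intro torsion_free_module.intro torsion_free_module_axioms.intro
    quotient_module_is_left_module regular_left_ore_axioms)
  fix s X
  assume s: "s \<in> S" and "X \<in> carrier (quotient_module R I)"
    and sX: "s \<odot>\<^bsub>quotient_module R I\<^esub> X = \<zero>\<^bsub>quotient_module R I\<^esub>"
  then obtain x where x: "x \<in> carrier R" "X = I +> x"
    unfolding quotient_module_sel by blast
  then have "s \<otimes> x \<in> I"
    using s sX coset_eq_ideal_iff[of "s \<otimes> x"] by simp
  with s x have "x \<in> I"
    using saturated_left by blast
  then show "X = \<zero>\<^bsub>quotient_module R I\<^esub>"
    using x coset_eq_ideal_iff by simp
qed

text \<open>The projection on denominators and numerators induces a surjective ring map out of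
  \<open>loc_ring R S\<close>. It kills s^-1 r exactly when r is in \<open>I\<close>, so its kernel
  is the extended ideal.\<close>

lemma loc_ring_quotient_iso:
  "loc_ring (R Quot I) ((+>) I ` S) \<simeq> (loc_ring R S Quot loc_ideal R S I)"
proof -
  let ?h = "(+>) I"
  interpret Q: regular_left_ore "R Quot I" "?h ` S"
    by (rule quotient_regular_left_ore)
  interpret l: loc_hom R "regular_module R" S "R Quot I" "regular_module (R Quot I)" "?h ` S" ?h ?h
    using rcos_ring_hom ring_hom_closed[OF rcos_ring_hom] ring_hom_add[OF rcos_ring_hom]
      ring_hom_mult[OF rcos_ring_hom]
    by (intro loc_hom.intro loc_hom_axioms.intro regular_torsion_free_module
        Q.regular_torsion_free_module) simp_all
  let ?\<phi> = "loc_map (R Quot I) (?h ` S) (regular_module (R Quot I)) ?h ?h"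
  interpret \<phi>: ring_hom_ring "loc_ring R S" "loc_ring (R Quot I) (?h ` S)" ?\<phi>
  proof (rule ring_hom_ringI)
    show "?\<phi> \<one>\<^bsub>loc_ring R S\<^esub> = \<one>\<^bsub>loc_ring (R Quot I) (?h ` S)\<^esub>"
      using S_one ring_hom_one[OF rcos_ring_hom] by (simp add: l.loc_map_lfrac)
  qed (use loc_ring_is_ring Q.loc_ring_is_ring l.loc_map_closed l.loc_map_add l.loc_map_smult
      in simp_all)
  have surj: "?\<phi> ` carrier (loc_ring R S) = carrier (loc_ring (R Quot I) (?h ` S))"
    using l.loc_map_surj carrier_Quot by simp
  have "?\<phi> X = \<zero>\<^bsub>loc_ring (R Quot I) (?h ` S)\<^esub> \<longleftrightarrow> X \<in> loc_ideal R S I"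
    if "X \<in> carrier (loc_ring R S)" for X
    using that
  proof (rule loc_ring_cases)
    fix s r assume sr: "s \<in> S" "r \<in> carrier R" "X = frac s r"
    then have "?\<phi> X = \<zero>\<^bsub>loc_ring (R Quot I) (?h ` S)\<^esub> \<longleftrightarrow> I +> r = \<zero>\<^bsub>R Quot I\<^esub>"
      using Q.reg.lfrac_eq_zero_iff[of "I +> s" "I +> r"] ring_hom_closed[OF rcos_ring_hom]
      by (simp add: l.loc_map_lfrac)
    then show ?thesis
      using sr coset_eq_ideal_iff frac_mem_loc_ideal_iff by (simp add: FactRing_def)
  qed
  then have "a_kernel (loc_ring R S) (loc_ring (R Quot I) (?h ` S)) ?\<phi> = loc_ideal R S I"
    unfolding a_kernel_def' using ideal.Icarr[OF loc_ideal_is_ideal] by blast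
  then have "(loc_ring R S Quot loc_ideal R S I) \<simeq> loc_ring (R Quot I) (?h ` S)"
    using \<phi>.FactRing_iso[OF surj] by simp
  then show ?thesis
    using ring_iso_sym ideal.quotient_is_ring[OF loc_ideal_is_ideal] by blast
qed

lemma loc_module_quotient_iso:
  "left_module_isomorphic (loc_ring R S) (quotient_module (loc_ring R S) (loc_ideal R S I))
    (loc_module R S (quotient_module R I))"
proof -
  interpret N: torsion_free_module R "quotient_module R I" S
    by (rule quotient_torsion_free_module)
  interpret l: loc_hom R "regular_module R" S R "quotient_module R I" S "\<lambda>x. x" "(+>) I"
    using regular_torsion_free_module quotient_torsion_free_module
    by (intro loc_hom.intro loc_hom_axioms.intro) (auto simp: a_rcos_sum ring_hom_def)
  interpret id: loc_hom R "regular_module R" S R "regular_module R" S "\<lambda>x. x" "\<lambda>x. x"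
    by (rule l.regular_loc_hom)
  let ?g = "loc_map R S (quotient_module R I) (\<lambda>x. x) ((+>) I)"
  \<comment> \<open>\<open>loc_map_smult\<close> sends the scalars through the map induced by
    \<open>h\<close>. For \<open>h\<close> the identity this map fixes every class, so
    \<open>?g\<close> is linear over the localized ring and not merely semilinear.\<close>
  have id: "loc_map R S (regular_module R) (\<lambda>x. x) (\<lambda>x. x) X = X"
    if "X \<in> carrier (loc_ring R S)" for X
    using that by (rule loc_ring_cases) (simp add: id.loc_map_lfrac)
  show ?thesis
  proof (rule ideal.quotient_module_isomorphic[OF loc_ideal_is_ideal, where g = ?g])
    show "left_module (loc_ring R S) (loc_module R S (quotient_module R I))"
      by (rule N.loc_module_is_left_module)
    show "?g ` carrier (loc_ring R S) = carrier (loc_module R S (quotient_module R I))"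
      using l.loc_map_surj by simp
    fix X assume X: "X \<in> carrier (loc_ring R S)"
    show "?g (X \<oplus>\<^bsub>loc_ring R S\<^esub> Y) = ?g X \<oplus>\<^bsub>loc_module R S (quotient_module R I)\<^esub> ?g Y"
      if "Y \<in> carrier (loc_ring R S)" for Y
      using l.loc_map_add X that by simp
    show "?g (A \<otimes>\<^bsub>loc_ring R S\<^esub> X) = A \<odot>\<^bsub>loc_module R S (quotient_module R I)\<^esub> ?g X"
      if "A \<in> carrier (loc_ring R S)" for A
      using l.loc_map_smult[of A X] id[OF that] X that by simp
    show "?g X = \<zero>\<^bsub>loc_module R S (quotient_module R I)\<^esub> \<longleftrightarrow> X \<in> loc_ideal R S I"
      using X
    proof (rule loc_ring_cases)
      fix s r assume sr: "s \<in> S" "r \<in> carrier R" "X = frac s r"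
      then show ?thesis
        using N.lfrac_eq_zero_iff[of s "I +> r"]
        by (simp add: l.loc_map_lfrac coset_eq_ideal_iff frac_mem_loc_ideal_iff)
    qed
  qed
qed

end

theorem theorem1p4:
  fixes R :: "('a, 'b) ring_scheme" and S :: "'a set"
  assumes "semiprime_ring R"
    and "S \<in> Den_l R {\<zero>\<^bsub>R\<^esub>}"
  shows "semiprime_ring (loc_ring R S) \<and>
    (finite (min_primes R) \<longrightarrow>
      min_primes (loc_ring R S) = {loc_ideal R S \<pp> |\<pp>. \<pp> \<in> min_primes R} \<and>
      bij_betw (loc_ideal R S) (min_primes R) (min_primes (loc_ring R S)) \<and>
      card (min_primes (loc_ring R S)) = card (min_primes R)) \<and>
    (finite (min_primes R) \<longrightarrow>
      (\<forall>\<pp>\<in>min_primes R.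
        (\<lambda>r. \<pp> +>\<^bsub>R\<^esub> r) ` S \<in> Den_l (R Quot \<pp>) {\<zero>\<^bsub>R Quot \<pp>\<^esub>} \<and>
        loc_ring (R Quot \<pp>) ((\<lambda>r. \<pp> +>\<^bsub>R\<^esub> r) ` S) \<simeq> (loc_ring R S Quot loc_ideal R S \<pp>) \<and>
        left_module_isomorphic (loc_ring R S)
          (quotient_module (loc_ring R S) (loc_ideal R S \<pp>))
          (loc_module R S (quotient_module R \<pp>))))"
proof (intro conjI impI ballI)
  have "ring R"
    using assms(1) by (simp add: semiprime_ring_def)
  then interpret regular_left_ore R S
    using assms(2) Den_l_zero_iff_regular_left_ore by blast
  show "semiprime_ring (loc_ring R S)"
    using assms(1) by (rule loc_ring_semiprime)
  assume fin: "finite (min_primes R)"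
  note min = min_primes_loc_ring[OF assms(1) fin]
  show "min_primes (loc_ring R S) = {loc_ideal R S \<pp> |\<pp>. \<pp> \<in> min_primes R}"
    using min(1) by blast
  show "bij_betw (loc_ideal R S) (min_primes R) (min_primes (loc_ring R S))"
    using min by (simp add: bij_betw_def)
  then show "card (min_primes (loc_ring R S)) = card (min_primes R)"
    by (simp add: bij_betw_same_card)
  fix \<pp> assume "\<pp> \<in> min_primes R"
  then interpret saturated_ideal R S \<pp>
    by (rule min_prime_saturated[OF assms(1) fin])
  show "(\<lambda>r. \<pp> +>\<^bsub>R\<^esub> r) ` S \<in> Den_l (R Quot \<pp>) {\<zero>\<^bsub>R Quot \<pp>\<^esub>}"
    using quotient_regular_left_ore Den_l_zero_iff_regular_left_ore[OF quotient_is_ring] by blast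
  show "loc_ring (R Quot \<pp>) ((\<lambda>r. \<pp> +>\<^bsub>R\<^esub> r) ` S) \<simeq> (loc_ring R S Quot loc_ideal R S \<pp>)"
    by (rule loc_ring_quotient_iso)
  show "left_module_isomorphic (loc_ring R S)
      (quotient_module (loc_ring R S) (loc_ideal R S \<pp>))
      (loc_module R S (quotient_module R \<pp>))"
    by (rule loc_module_quotient_iso)
qed

end
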